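(* For any integers $n\leq k$, the minimum number of adaptive queries needed to solve sparse set query with parameters $k,n$ is $\Theta\left(n\frac{\log(1+k/n)}{\log n}+k/n\right)$ (with absolute implicit constants).
   Context: Sparse set query with parameters $k\geq n$: Codemaker chooses a hidden set $f\subseteq[k]$ with $|f|\leq n$ (the set of counterfeit coins among $k$ coins). Codebreaker adaptively asks queries, each a set $q\subseteq[k]$ with $|q|\leq n$ (each query may depend on the previous answers), and is told $|f\cap q|$. The game is solved once the answers determine $f$ uniquely among all subsets of $[k]$ of size at most $n$. The minimum number of adaptive queries needed is the least $T$ such that Codebreaker has an adaptive strategy determining every possible $f$ within $T$ queries. *)

theory Defs
  imports Complex_Main
begin

definition sparse_sets :: "nat \<Rightarrow> nat \<Rightarrow> nat set set" where
  "sparse_sets n k = {A. A \<subseteq> {1..k} \<and> card A \<le> n}"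

text \<open>An adaptive strategy maps the list of answers received so far (oldest first) to the next
  query. Earlier queries need not be recorded, as they are determined by the earlier answers.\<close>

type_synonym strategy = "nat list \<Rightarrow> nat set"

definition valid_strategy :: "nat \<Rightarrow> nat \<Rightarrow> strategy \<Rightarrow> bool" where
  "valid_strategy n k S \<longleftrightarrow> (\<forall>h. S h \<in> sparse_sets n k)"

fun answers :: "strategy \<Rightarrow> nat set \<Rightarrow> nat \<Rightarrow> nat list" where
  "answers S f 0 = []"
| "answers S f (Suc t) = (let h = answers S f t in h @ [card (f \<inter> S h)])"

definition solved_after :: "nat \<Rightarrow> nat \<Rightarrow> strategy \<Rightarrow> nat set \<Rightarrow> nat \<Rightarrow> bool" where
  "solved_after n k S f t \<longleftrightarrow>
     (\<forall>g \<in> sparse_sets n k. answers S g t = answers S f t \<longrightarrow> g = f)"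

definition solvable_within :: "nat \<Rightarrow> nat \<Rightarrow> nat \<Rightarrow> bool" where
  "solvable_within n k T \<longleftrightarrow>
     (\<exists>S. valid_strategy n k S \<and>
       (\<forall>f \<in> sparse_sets n k. \<exists>t \<le> T. solved_after n k S f t))"

definition min_queries :: "nat \<Rightarrow> nat \<Rightarrow> nat" where
  "min_queries n k = (LEAST T. solvable_within n k T)"

text \<open>For positive \<open>n\<close> the minimum is over a nonempty set: query the coins one at a time.\<close>

lemma solvable_within_k:
  assumes "n \<ge> 1"
  shows "solvable_within n k k"
proof -
  define S :: strategy where
    "S = (\<lambda>h. if length h < k then {Suc (length h)} else {})"
  have valid: "valid_strategy n k S"
    using assms by (auto simp: valid_strategy_def sparse_sets_def S_def)
  have len: "length (answers S f t) = t" for f t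
    by (induction t) (simp_all add: Let_def)
  have agree: "Suc i \<in> f \<longleftrightarrow> Suc i \<in> g"
    if "answers S f t = answers S g t" "i < t" "t \<le> k" for f g t i
    using that
  proof (induction t)
    case (Suc t)
    have query: "S (answers S h t) = {Suc t}" for h
      using Suc.prems(3) len[of h t] by (simp add: S_def)
    have "answers S f t = answers S g t"
      and "card (f \<inter> {Suc t}) = card (g \<inter> {Suc t})"
      using Suc.prems(1) by (simp_all add: Let_def query)
    moreover from this(2) have "Suc t \<in> f \<longleftrightarrow> Suc t \<in> g"
      by (cases "Suc t \<in> f"; cases "Suc t \<in> g") auto
    ultimately show ?case
      using Suc by (cases "i = t") auto
  qed simp
  have "g = f" if fg: "f \<in> sparse_sets n k" "g \<in> sparse_sets n k"
      and eq: "answers S g k = answers S f k" for f g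
  proof -
    have sub: "f \<subseteq> {1..k}" "g \<subseteq> {1..k}"
      using fg by (auto simp: sparse_sets_def)
    have "x \<in> g \<longleftrightarrow> x \<in> f" if "x \<in> {1..k}" for x
      using agree[OF eq, of "x - 1"] that by auto
    with sub show ?thesis by blast
  qed
  then show ?thesis
    using valid unfolding solvable_within_def solved_after_def by blast
qed

lemma solvable_within_min_queries:
  "n \<ge> 1 \<Longrightarrow> solvable_within n k (min_queries n k)"
  unfolding min_queries_def by (rule LeastI) (rule solvable_within_k)

text \<open>For \<open>n = 1\<close>, where \<open>log n\<close> vanishes, the first summand is \<open>0\<close> by the library's convention
  for division by zero, and the bound is simply \<open>k\<close>.\<close>

definition query_bound :: "nat \<Rightarrow> nat \<Rightarrow> real" where
  "query_bound n k = real n * (ln (1 + real k / real n) / ln (real n)) + real k / real n"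

end

theory Submission
  imports Defs
begin

text \<open>Lower bound: \<open>T\<close> answers in \<open>{0..n}\<close> must separate at least \<open>max 2 (k/n) ^ n\<close> sets, and
  against the empty set every coin has to be queried.

  Upper bound, \<open>k/n\<close> at most a small power of \<open>n\<close>: cut the coins into \<open>n\<close> regions of
  \<open>2 ^ d\<close>, about \<open>k/n\<close>, coins, find all counts with Lindstrom's weighing design, and halve all
  regions \<open>d\<close> times, each time finding the new counts with the design. Every query contributes
  a number of bits proportional to \<open>log n\<close>.

  Upper bound, larger \<open>k\<close>: here \<open>O(n + k/n)\<close> queries are allowed, but the regions start with about
  \<open>n\<close> coins, and a query of size \<open>n\<close> to such regions alone yields only a bounded number of bits.
  The signed sums of Cantor and Mills allow a query to combine one set from each node of a
  binary tree, where a set used at height \<open>h\<close> may have up to \<open>4 ^ h\<close> elements; so regions of all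
  sizes must be refined at the same time. The regions are therefore grouped into batches, which
  enter a pipeline one after the other and descend one level of the tree per round.\<close>

section \<open>Adaptive strategies and revealed counts\<close>

text \<open>The size limit fixes the border between the regimes. A query of the design with words of
  \<open>D\<close> bits may meet \<open>4 ^ D * D\<close> regions, so it is legal for regions of
  \<open>2 ^ d\<close> coins if \<open>4 ^ D * D * 2 ^ d \<le> n\<close>. With
  \<open>16 ^ D \<le> n < 16 ^ Suc D\<close> this covers all \<open>d < D\<close>; beyond,
  \<open>ln (1 + k / n)\<close> is already of order \<open>ln n\<close>, and the target becomes
  \<open>n + k / n\<close>. A halving round stays within O(n / D) queries, however many regions
  there are, because a count \<open>s\<close> is allotted at most \<open>s\<close> bits and the
  counts add up to at most \<open>n\<close>. In the pipeline \<open>4 ^ L\<close> is the largest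
  power of 4 up to \<open>n\<close>, so \<open>2 ^ L\<close> is about sqrt n. A batch has at most
  \<open>2 ^ (L - 1)\<close> coins, which leads to O(sqrt n) batches and rounds; a round costs
  O(sqrt n) queries, all levels together, and the total is O(n). Adaptivity is used only between
  rounds; the queries within a round are fixed in advance.\<close>

lemma ex_cut:
  assumes "finite R" "card R \<le> a * b"
  shows "\<exists>pt :: 'a \<Rightarrow> nat. (\<forall>x\<in>R. pt x < a) \<and> (\<forall>i. card {x\<in>R. pt x = i} \<le> b)"
proof -
  obtain g where g: "bij_betw g R {0..<card R}"
    using ex_bij_betw_finite_nat[OF assms(1)] by blast
  have "g x div b < a" if "x \<in> R" for x
  proof -
    have "g x < a * b"
      using bij_betwE[OF g] that assms(2) by fastforce
    then show ?thesis
      by (simp add: less_mult_imp_div_less)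
  qed
  moreover have "card {x\<in>R. g x div b = i} \<le> b" for i
  proof (cases "b = 0")
    case True
    then have "R = {}" using assms by simp
    then show ?thesis by simp
  next
    case False
    have "card {x\<in>R. g x div b = i} \<le> card {i * b..<i * b + b}"
    proof (rule card_inj_on_le)
      show "inj_on g {x\<in>R. g x div b = i}"
        using g by (auto simp: bij_betw_def inj_on_def)
      show "g ` {x\<in>R. g x div b = i} \<subseteq> {i * b..<i * b + b}"
        using False dividend_less_div_times[of b] by (auto simp: algebra_simps)
    qed simp
    then show ?thesis by simp
  qed
  ultimately show ?thesis
    by (intro exI[of _ "\<lambda>x. g x div b"]) auto
qed

lemma card_fibres:
  assumes "finite R" "\<And>x. x \<in> R \<Longrightarrow> pt x < (a::nat)"
  shows "card R = (\<Sum>i<a. card {x\<in>R. pt x = i})"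
proof -
  have "R = (\<Union>i<a. {x\<in>R. pt x = i})"
    using assms(2) by auto
  then have "card R = card (\<Union>i<a. {x\<in>R. pt x = i})" by simp
  also have "\<dots> = (\<Sum>i<a. card {x\<in>R. pt x = i})"
    using assms(1) by (intro card_UN_disjoint) auto
  finally show ?thesis .
qed

lemma length_answers [simp]: "length (answers S f t) = t"
  by (induction t) (simp_all add: Let_def)

lemma answers_prefix:
  assumes "answers S f T = answers S g T" "t \<le> T"
  shows "answers S f t = answers S g t"
  using assms
proof (induction T)
  case (Suc T)
  then show ?case by (cases "t = Suc T") (auto simp: Let_def)
qed simp

lemma answers_Suc_shift:
  "answers S f (Suc t) =
    card (f \<inter> S []) # answers (\<lambda>h. S (card (f \<inter> S []) # h)) f t"
  by (induction t) (simp_all add: Let_def)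

section \<open>The game as a recursion on the set of remaining candidates\<close>

locale sparse_query =
  fixes n k :: nat
  assumes n_pos: "1 \<le> n"
begin

text \<open>Only the set \<open>F\<close> of candidates still possible matters for the rest of the
  game. Recursion on \<open>F\<close> avoids histories; \<open>solvable_strategy\<close> translates
  back once and for all.\<close>

fun solvable :: "nat \<Rightarrow> nat set set \<Rightarrow> bool" where
  "solvable 0 F \<longleftrightarrow> (\<forall>f\<in>F. \<forall>g\<in>F. f = g)"
| "solvable (Suc t) F \<longleftrightarrow>
    (\<exists>q\<in>sparse_sets n k. \<forall>f\<in>F. solvable t {g\<in>F. card (g \<inter> q) = card (f \<inter> q)})"

lemma empty_sparse: "{} \<in> sparse_sets n k"
  by (simp add: sparse_sets_def)

lemma solvable_subset:
  "solvable t F \<Longrightarrow> F' \<subseteq> F \<Longrightarrow> solvable t F'"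
proof (induction t arbitrary: F F')
  case 0
  then show ?case by auto
next
  case (Suc t)
  then obtain q where q: "q \<in> sparse_sets n k"
    "\<And>f. f \<in> F \<Longrightarrow> solvable t {g\<in>F. card (g \<inter> q) = card (f \<inter> q)}"
    by auto
  have "solvable t {g\<in>F'. card (g \<inter> q) = card (f \<inter> q)}" if "f \<in> F'" for f
    using Suc.prems(2) that by (intro Suc.IH[OF q(2)]) auto
  then show ?case using q(1) by auto
qed

lemma solvable_Suc: "solvable t F \<Longrightarrow> solvable (Suc t) F"
  using empty_sparse by (auto intro!: bexI[of _ "{}"])

lemma solvable_mono: "solvable t F \<Longrightarrow> t \<le> t' \<Longrightarrow> solvable t' F"
proof (induction t')
  case (Suc t')
  then show ?case by (cases "t = Suc t'") (auto intro: solvable_Suc simp del: solvable.simps)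
qed simp

lemma solvable_strategy:
  "solvable t F \<Longrightarrow> \<exists>S. valid_strategy n k S \<and>
    (\<forall>f\<in>F. \<forall>g\<in>F. answers S f t = answers S g t \<longrightarrow> f = g)"
proof (induction t arbitrary: F)
  case 0
  then show ?case
    using empty_sparse by (auto simp: valid_strategy_def intro!: exI[of _ "\<lambda>_. {}"])
next
  case (Suc t)
  then obtain q where q: "q \<in> sparse_sets n k"
    "\<And>f. f \<in> F \<Longrightarrow> solvable t {g\<in>F. card (g \<inter> q) = card (f \<inter> q)}"
    by auto
  \<comment> \<open>Choice needs a strategy for every number \<open>a\<close>; an answer that no
    candidate produces gets the constant empty query.\<close>
  have "\<exists>S. valid_strategy n k S \<and>
      (\<forall>f\<in>{g\<in>F. card (g \<inter> q) = a}. \<forall>g\<in>{g\<in>F. card (g \<inter> q) = a}.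
         answers S f t = answers S g t \<longrightarrow> f = g)" for a
  proof (cases "\<exists>f\<in>F. card (f \<inter> q) = a")
    case True
    then show ?thesis using Suc.IH[OF q(2)] by auto
  next
    case False
    then show ?thesis
      using empty_sparse by (auto simp: valid_strategy_def intro!: exI[of _ "\<lambda>_. {}"])
  qed
  then obtain S where S: "\<And>a. valid_strategy n k (S a)"
    "\<And>a f g. f \<in> F \<Longrightarrow> g \<in> F \<Longrightarrow> card (f \<inter> q) = a \<Longrightarrow> card (g \<inter> q) = a \<Longrightarrow>
        answers (S a) f t = answers (S a) g t \<Longrightarrow> f = g"
    by (simp add: Ball_def) metis
  define R where "R = (\<lambda>h. case h of [] \<Rightarrow> q | a # h' \<Rightarrow> S a h')"
  have ans: "answers R f (Suc t) = card (f \<inter> q) # answers (S (card (f \<inter> q))) f t" for f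
    unfolding answers_Suc_shift by (simp add: R_def)
  have "valid_strategy n k R"
    using q(1) S(1) by (auto simp: valid_strategy_def R_def split: list.split)
  moreover have "f = g" if "f \<in> F" "g \<in> F" "answers R f (Suc t) = answers R g (Suc t)" for f g
    using that(3) unfolding ans list.inject by (intro S(2)[OF that(1,2) refl]) metis+
  ultimately show ?case by blast
qed

lemma min_queries_le:
  assumes "solvable t (sparse_sets n k)"
  shows "min_queries n k \<le> t"
proof -
  obtain S where "valid_strategy n k S"
    "\<forall>f\<in>sparse_sets n k. \<forall>g\<in>sparse_sets n k. answers S f t = answers S g t \<longrightarrow> f = g"
    using solvable_strategy[OF assms] by blast
  then have "solvable_within n k t"
    unfolding solvable_within_def solved_after_def by (metis order_refl)
  then show ?thesis
    unfolding min_queries_def by (rule Least_le)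
qed

text \<open>Models one round of queries fixed in advance. That the answers determine the counts is
  expressed as injectivity on the candidates, so that no decoding procedure has to be given.\<close>

definition reveals :: "nat \<Rightarrow> nat set set \<Rightarrow> nat set set \<Rightarrow> bool" where
  "reveals N F \<H> \<longleftrightarrow> (\<exists>Q. finite Q \<and> Q \<subseteq> sparse_sets n k \<and> card Q \<le> N \<and>
     (\<forall>f\<in>F. \<forall>g\<in>F. (\<forall>q\<in>Q. card (f \<inter> q) = card (g \<inter> q)) \<longrightarrow>
        (\<forall>H\<in>\<H>. card (f \<inter> H) = card (g \<inter> H))))"

lemma revealsI:
  assumes "finite Q" "Q \<subseteq> sparse_sets n k" "card Q \<le> N"
    "\<And>f g H. f \<in> F \<Longrightarrow> g \<in> F \<Longrightarrow> (\<And>q. q \<in> Q \<Longrightarrow> card (f \<inter> q) = card (g \<inter> q)) \<Longrightarrow>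
       H \<in> \<H> \<Longrightarrow> card (f \<inter> H) = card (g \<inter> H)"
  shows "reveals N F \<H>"
  unfolding reveals_def using assms by (intro exI[of _ Q]) blast

text \<open>Counts that can be computed from known ones cost no query; the computation may use
  whatever all candidates in \<open>F\<close> have in common.\<close>

lemma reveals_trans:
  assumes "reveals N F \<H>"
    "\<And>f g H. f \<in> F \<Longrightarrow> g \<in> F \<Longrightarrow> (\<And>H. H \<in> \<H> \<Longrightarrow> card (f \<inter> H) = card (g \<inter> H)) \<Longrightarrow>
       H \<in> \<H>' \<Longrightarrow> card (f \<inter> H) = card (g \<inter> H)"
    "N \<le> N'"
  shows "reveals N' F \<H>'"
proof -
  obtain Q where "finite Q" "Q \<subseteq> sparse_sets n k" "card Q \<le> N"
     "\<And>f g H. f \<in> F \<Longrightarrow> g \<in> F \<Longrightarrow> (\<forall>q\<in>Q. card (f \<inter> q) = card (g \<inter> q)) \<Longrightarrow>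
        H \<in> \<H> \<Longrightarrow> card (f \<inter> H) = card (g \<inter> H)"
    using assms(1) unfolding reveals_def by blast
  note Q = this
  show ?thesis
  proof (rule revealsI[OF Q(1,2)])
    show "card Q \<le> N'" using Q(3) assms(3) by (rule order_trans)
    show "card (f \<inter> H) = card (g \<inter> H)"
      if "f \<in> F" "g \<in> F" "\<And>q. q \<in> Q \<Longrightarrow> card (f \<inter> q) = card (g \<inter> q)" "H \<in> \<H>'" for f g H
      using that by (intro assms(2)[OF that(1,2) Q(4)]) blast+
  qed
qed

lemma reveals_mono:
  assumes "reveals N F \<H>" "N \<le> N'"
  shows "reveals N' F \<H>"
proof -
  obtain Q where "finite Q" "Q \<subseteq> sparse_sets n k" "card Q \<le> N"
     "\<And>f g H. f \<in> F \<Longrightarrow> g \<in> F \<Longrightarrow> (\<forall>q\<in>Q. card (f \<inter> q) = card (g \<inter> q)) \<Longrightarrow>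
        H \<in> \<H> \<Longrightarrow> card (f \<inter> H) = card (g \<inter> H)"
    using assms(1) unfolding reveals_def by blast
  then show ?thesis
    unfolding reveals_def using assms(2) by (intro exI[of _ Q]) (meson order_trans)
qed

lemma reveals_empty: "reveals 0 F {}"
  by (rule revealsI[of "{}"]) (simp_all only: finite.emptyI empty_subsetI card.empty order_refl empty_iff)

lemma reveals_Un:
  assumes "reveals N F \<H>" "reveals N' F \<H>'"
  shows "reveals (N + N') F (\<H> \<union> \<H>')"
proof -
  obtain Q where Q: "finite Q" "Q \<subseteq> sparse_sets n k" "card Q \<le> N"
     "\<And>f g H. f \<in> F \<Longrightarrow> g \<in> F \<Longrightarrow> (\<forall>q\<in>Q. card (f \<inter> q) = card (g \<inter> q)) \<Longrightarrow>
        H \<in> \<H> \<Longrightarrow> card (f \<inter> H) = card (g \<inter> H)"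
    using assms(1) unfolding reveals_def by blast
  obtain Q' where Q': "finite Q'" "Q' \<subseteq> sparse_sets n k" "card Q' \<le> N'"
     "\<And>f g H. f \<in> F \<Longrightarrow> g \<in> F \<Longrightarrow> (\<forall>q\<in>Q'. card (f \<inter> q) = card (g \<inter> q)) \<Longrightarrow>
        H \<in> \<H>' \<Longrightarrow> card (f \<inter> H) = card (g \<inter> H)"
    using assms(2) unfolding reveals_def by blast
  show ?thesis
  proof (rule revealsI[of "Q \<union> Q'"])
    show "card (Q \<union> Q') \<le> N + N'"
      using card_Un_le[of Q Q'] Q(3) Q'(3) by linarith
    show "card (f \<inter> H) = card (g \<inter> H)"
      if "f \<in> F" "g \<in> F" "\<And>q. q \<in> Q \<union> Q' \<Longrightarrow> card (f \<inter> q) = card (g \<inter> q)" "H \<in> \<H> \<union> \<H>'" for f g H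
      using that(4) by (elim UnE; intro Q(4)[OF that(1,2)] Q'(4)[OF that(1,2)])
        (use that(3) in blast)+
  qed (use Q(1,2) Q'(1,2) in auto)
qed

lemma reveals_UN:
  assumes "finite I" "\<And>i. i \<in> I \<Longrightarrow> reveals (N i) F (\<H> i)"
  shows "reveals (\<Sum>i\<in>I. N i) F (\<Union>i\<in>I. \<H> i)"
  using assms
proof (induction I rule: finite_induct)
  case empty
  then show ?case by (simp add: reveals_empty)
next
  case (insert i I)
  then show ?case using reveals_Un[of "N i" F "\<H> i"] by simp
qed

lemma reveals_UN_bound:
  assumes "finite I" "\<And>i. i \<in> I \<Longrightarrow> reveals N F (\<H> i)"
  shows "reveals (card I * N) F (\<Union>i\<in>I. \<H> i)"
  using reveals_UN[of I "\<lambda>_. N" F \<H>] assms by simp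

text \<open>Sets larger than \<open>n\<close> are not legal queries; they are asked piecewise.\<close>

lemma reveals_single:
  assumes "H \<subseteq> {1..k}"
  shows "reveals (card H div n + 1) F {H}"
proof -
  let ?a = "card H div n + 1"
  have fin: "finite H" using assms finite_subset by blast
  have "card H mod n \<le> n"
    using n_pos by simp
  then have "card H \<le> ?a * n"
    using div_mult_mod_eq[of "card H" n] by (simp only: add_mult_distrib mult_1)
  then obtain pt :: "nat \<Rightarrow> nat" where pt: "\<forall>x\<in>H. pt x < ?a" "\<forall>i. card {x\<in>H. pt x = i} \<le> n"
    using ex_cut[OF fin] by blast
  let ?P = "\<lambda>i. {x\<in>H. pt x = i}"
  have sum: "card (f \<inter> H) = (\<Sum>i<?a. card (f \<inter> ?P i))" for f
  proof -
    have "card (f \<inter> H) = (\<Sum>i<?a. card {x\<in>f \<inter> H. pt x = i})"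
      using fin pt(1) by (intro card_fibres) auto
    also have "\<dots> = (\<Sum>i<?a. card (f \<inter> ?P i))"
      by (intro sum.cong arg_cong[of _ _ card]) auto
    finally show ?thesis .
  qed
  show ?thesis
  proof (rule revealsI[of "?P ` {..<?a}"])
    show "?P ` {..<?a} \<subseteq> sparse_sets n k"
      using pt(2) assms by (auto simp: sparse_sets_def)
    show "card (?P ` {..<?a}) \<le> ?a"
      using card_image_le[of "{..<?a}" ?P] by simp
    show "card (f \<inter> A) = card (g \<inter> A)"
      if "\<And>q. q \<in> ?P ` {..<?a} \<Longrightarrow> card (f \<inter> q) = card (g \<inter> q)" "A \<in> {H}" for f g A
      using that by (simp add: sum del: sum.lessThan_Suc)
  qed simp
qed

lemma reveals_direct:
  assumes "finite \<H>" "\<And>H. H \<in> \<H> \<Longrightarrow> H \<subseteq> {1..k} \<and> card H \<le> n"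
  shows "reveals (card \<H>) F \<H>"
proof (rule revealsI[of \<H>])
  show "\<H> \<subseteq> sparse_sets n k" using assms(2) by (auto simp: sparse_sets_def)
qed (use assms(1) in \<open>blast+\<close>)

lemma solvable_queries:
  assumes "finite Q" "Q \<subseteq> sparse_sets n k"
    "\<And>f. f \<in> F \<Longrightarrow> solvable t {g\<in>F. \<forall>q\<in>Q. card (g \<inter> q) = card (f \<inter> q)}"
  shows "solvable (card Q + t) F"
  using assms
proof (induction Q arbitrary: F rule: finite_induct)
  case empty
  show ?case
  proof (cases "F = {}")
    case True
    have "solvable 0 F" using True by simp
    then show ?thesis using solvable_mono by blast
  next
    case False
    then show ?thesis using empty by auto
  qed
next
  case (insert p Q)
  have "solvable (card Q + t) {g\<in>F. card (g \<inter> p) = card (f \<inter> p)}" if "f \<in> F" for f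
  proof (rule insert.IH)
    show "solvable t {g \<in> {g \<in> F. card (g \<inter> p) = card (f \<inter> p)}.
        \<forall>q\<in>Q. card (g \<inter> q) = card (f' \<inter> q)}"
      if "f' \<in> {g \<in> F. card (g \<inter> p) = card (f \<inter> p)}" for f'
      using that by (intro solvable_subset[OF insert.prems(2)[of f']]) auto
  qed (use insert in auto)
  then show ?case using insert by auto
qed

lemma solvable_reveals:
  assumes "reveals N F \<H>"
    "\<And>f. f \<in> F \<Longrightarrow> solvable t {g\<in>F. \<forall>H\<in>\<H>. card (g \<inter> H) = card (f \<inter> H)}"
  shows "solvable (N + t) F"
proof -
  obtain Q where Q: "finite Q" "Q \<subseteq> sparse_sets n k" "card Q \<le> N"
     "\<And>f g H. f \<in> F \<Longrightarrow> g \<in> F \<Longrightarrow> (\<forall>q\<in>Q. card (f \<inter> q) = card (g \<inter> q)) \<Longrightarrow>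
        H \<in> \<H> \<Longrightarrow> card (f \<inter> H) = card (g \<inter> H)"
    using assms(1) unfolding reveals_def by blast
  have "solvable (card Q + t) F"
  proof (rule solvable_queries[OF Q(1,2)])
    fix f assume f: "f \<in> F"
    show "solvable t {g\<in>F. \<forall>q\<in>Q. card (g \<inter> q) = card (f \<inter> q)}"
      using Q(4)[OF _ f] by (intro solvable_subset[OF assms(2)[OF f]]) auto
  qed
  then show ?thesis using Q(3) by (auto intro: solvable_mono)
qed

section \<open>Positions: disjoint regions with known counts\<close>

definition consistent :: "nat set set \<Rightarrow> nat set \<Rightarrow> nat set set" where
  "consistent \<P> f = {g. g \<subseteq> \<Union>\<P> \<and> (\<forall>R\<in>\<P>. card (g \<inter> R) = card (f \<inter> R))}"

text \<open>The known counts are recorded through one candidate \<open>f\<close> that has them.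
  Since every region holds a coin, sums over regions can be charged to the at most \<open>n\<close>
  coins.\<close>

definition position :: "nat set set \<Rightarrow> nat set \<Rightarrow> bool" where
  "position \<P> f \<longleftrightarrow> finite \<P> \<and> pairwise disjnt \<P> \<and> \<Union>\<P> \<subseteq> {1..k} \<and> f \<subseteq> \<Union>\<P> \<and>
     (\<forall>R\<in>\<P>. f \<inter> R \<noteq> {}) \<and> card f \<le> n"

lemma position_finite:
  assumes "position \<P> f"
  shows "finite \<P>" "finite (\<Union>\<P>)" "finite f" "R \<in> \<P> \<Longrightarrow> finite R"
proof -
  show "finite \<P>" using assms by (simp add: position_def)
  show fin: "finite (\<Union>\<P>)" using assms by (auto simp: position_def intro: finite_subset)
  show "finite f" using assms fin by (auto simp: position_def intro: finite_subset)
  show "R \<in> \<P> \<Longrightarrow> finite R" using fin by (meson Union_upper finite_subset)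
qed

lemma card_regions:
  assumes "finite (\<Union>\<P>)" "pairwise disjnt \<P>" "\<B> \<subseteq> \<P>"
  shows "(\<Sum>R\<in>\<B>. card (f \<inter> R)) = card (f \<inter> \<Union>\<B>)"
proof -
  have fin: "finite \<B>" "\<And>R. R \<in> \<B> \<Longrightarrow> finite R"
    using assms by (auto dest: finite_UnionD intro: finite_subset)
  have "card (\<Union>R\<in>\<B>. f \<inter> R) = (\<Sum>R\<in>\<B>. card (f \<inter> R))"
    using fin assms(2,3) by (intro card_UN_disjoint) (auto simp: pairwise_def disjnt_def)
  also have "(\<Union>R\<in>\<B>. f \<inter> R) = f \<inter> \<Union>\<B>" by auto
  finally show ?thesis by simp
qed

lemma position_sum:
  assumes "position \<P> f" "\<B> \<subseteq> \<P>"
  shows "(\<Sum>R\<in>\<B>. card (f \<inter> R)) = card (f \<inter> \<Union>\<B>)" "(\<Sum>R\<in>\<B>. card (f \<inter> R)) \<le> n"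
proof -
  show eq: "(\<Sum>R\<in>\<B>. card (f \<inter> R)) = card (f \<inter> \<Union>\<B>)"
    using assms position_finite[OF assms(1)] by (intro card_regions) (auto simp: position_def)
  have "card (f \<inter> \<Union>\<B>) \<le> card f"
    using position_finite[OF assms(1)] by (intro card_mono) auto
  then show "(\<Sum>R\<in>\<B>. card (f \<inter> R)) \<le> n"
    using assms eq by (simp add: position_def)
qed

lemma position_pos:
  assumes "position \<P> f" "R \<in> \<P>"
  shows "1 \<le> card (f \<inter> R)"
  using assms position_finite[OF assms(1)] by (auto simp: position_def Suc_le_eq card_gt_0_iff)

lemma position_consistent:
  assumes "position \<P> f" "h \<in> consistent \<P> f"
  shows "position \<P> h" "\<B> \<subseteq> \<P> \<Longrightarrow> card (h \<inter> \<Union>\<B>) = card (f \<inter> \<Union>\<B>)"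
proof -
  have fin: "finite (\<Union>\<P>)" using position_finite[OF assms(1)] by simp
  have dis: "pairwise disjnt \<P>" using assms by (simp add: position_def)
  show eq: "card (h \<inter> \<Union>\<B>) = card (f \<inter> \<Union>\<B>)" if "\<B> \<subseteq> \<P>" for \<B>
    using card_regions[OF fin dis that, of h] card_regions[OF fin dis that, of f] assms(2) that
    by (auto simp: consistent_def subset_iff)
  have "h \<inter> \<Union>\<P> = h" "f \<inter> \<Union>\<P> = f"
    using assms by (auto simp: consistent_def position_def)
  then have "card h \<le> n" using eq[of \<P>] assms by (simp add: position_def)
  moreover have "h \<inter> R \<noteq> {}" if "R \<in> \<P>" for R
    using position_pos[OF assms(1) that] assms(2) that by (auto simp: consistent_def)
  ultimately show "position \<P> h"
    using assms by (auto simp: position_def consistent_def)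
qed

text \<open>Regions found to contain no coin are dropped, so that the number of regions never
  exceeds the number of coins.\<close>

lemma solvable_partition:
  assumes "reveals N F \<H>" "finite \<H>" "pairwise disjnt \<H>" "\<Union>\<H> \<subseteq> {1..k}"
    "\<And>f. f \<in> F \<Longrightarrow> f \<subseteq> \<Union>\<H> \<and> card f \<le> n"
    "\<And>\<P> f. f \<in> F \<Longrightarrow> position \<P> f \<Longrightarrow> \<P> \<subseteq> \<H> \<Longrightarrow> solvable t (consistent \<P> f)"
  shows "solvable (N + t) F"
proof (rule solvable_reveals[OF assms(1)])
  fix f assume f: "f \<in> F"
  let ?P = "{P\<in>\<H>. f \<inter> P \<noteq> {}}"
  have fin: "finite f"
    using assms(4) assms(5)[OF f] by (meson finite_atLeastAtMost finite_subset)
  have "position ?P f"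
    unfolding position_def
  proof (intro conjI)
    show "pairwise disjnt ?P" using assms(3) by (auto simp: pairwise_def)
    show "f \<subseteq> \<Union>?P" using assms(5)[OF f] by blast
  qed (use assms(2,4) assms(5)[OF f] in auto)
  then have sol: "solvable t (consistent ?P f)"
    by (rule assms(6)[OF f]) auto
  have "g \<in> consistent ?P f" if "g \<in> F" "\<forall>H\<in>\<H>. card (g \<inter> H) = card (f \<inter> H)" for g
  proof -
    have fing: "finite g"
      using assms(4) assms(5)[OF that(1)] by (meson finite_atLeastAtMost finite_subset)
    have "x \<in> \<Union>?P" if x: "x \<in> g" for x
    proof -
      obtain H where H: "H \<in> \<H>" "x \<in> H"
        using assms(5)[OF \<open>g \<in> F\<close>] x by blast
      then have "card (g \<inter> H) > 0" using fing x by (auto simp: card_gt_0_iff)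
      then have "f \<inter> H \<noteq> {}"
        using \<open>\<forall>H\<in>\<H>. card (g \<inter> H) = card (f \<inter> H)\<close> H by auto
      then show ?thesis using H by auto
    qed
    then show ?thesis using that by (auto simp: consistent_def)
  qed
  then show "solvable t {g\<in>F. \<forall>H\<in>\<H>. card (g \<inter> H) = card (f \<inter> H)}"
    by (intro solvable_subset[OF sol]) auto
qed

text \<open>One round, with a single cutting function \<open>pt\<close> for all regions in
  \<open>A\<close>. Queries are spent on the parts only, because the counts of the regions left
  alone are contained in the consistency with \<open>f\<close>.\<close>

lemma solvable_refine:
  assumes "position \<P> f" "A \<subseteq> \<P>" "\<And>x. x \<in> \<Union>A \<Longrightarrow> pt x < a"
    "reveals N (consistent \<P> f) {{x\<in>R. pt x = i} | R i. R \<in> A \<and> i < (a::nat)}"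
    "\<And>\<P>' h. position \<P>' h \<Longrightarrow> h \<in> consistent \<P> f \<Longrightarrow>
       (\<And>P. P \<in> \<P>' \<Longrightarrow> P \<in> \<P> - A \<or> (\<exists>R\<in>A. \<exists>i<a. P = {x\<in>R. pt x = i})) \<Longrightarrow>
       solvable t (consistent \<P>' h)"
  shows "solvable (N + t) (consistent \<P> f)"
proof -
  let ?C = "{{x\<in>R. pt x = i} | R i. R \<in> A \<and> i < (a::nat)}"
  have fin: "finite \<P>" "\<Union>\<P> \<subseteq> {1..k}" and dis: "pairwise disjnt \<P>"
    using assms(1) by (auto simp: position_def)
  have finC: "finite ?C"
  proof -
    have "?C = (\<lambda>(R, i). {x\<in>R. pt x = i}) ` (A \<times> {..<a})" by auto
    then show ?thesis using fin assms(2) by (auto intro: finite_subset)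
  qed
  have "reveals N (consistent \<P> f) (\<P> - A \<union> ?C)"
  proof (rule reveals_trans[OF assms(4)])
    fix f' g H
    assume "f' \<in> consistent \<P> f" "g \<in> consistent \<P> f" "H \<in> \<P> - A \<union> ?C"
      and eq: "\<And>H. H \<in> ?C \<Longrightarrow> card (f' \<inter> H) = card (g \<inter> H)"
    then show "card (f' \<inter> H) = card (g \<inter> H)"
      by (elim UnE) (auto simp: consistent_def)
  qed simp
  then show ?thesis
  proof (rule solvable_partition)
    show "finite (\<P> - A \<union> ?C)" using finC fin by simp
    show "pairwise disjnt (\<P> - A \<union> ?C)"
    proof (rule pairwiseI)
      fix X Y assume XY: "X \<in> \<P> - A \<union> ?C" "Y \<in> \<P> - A \<union> ?C" "X \<noteq> Y"
      have "\<exists>R\<in>\<P>. \<exists>i. (X = R \<and> R \<notin> A \<or> X = {x\<in>R. pt x = i} \<and> R \<in> A)"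
        using XY(1) assms(2) by auto
      then obtain R i where R: "R \<in> \<P>" "X = R \<and> R \<notin> A \<or> X = {x\<in>R. pt x = i} \<and> R \<in> A" by blast
      have "\<exists>R\<in>\<P>. \<exists>i. (Y = R \<and> R \<notin> A \<or> Y = {x\<in>R. pt x = i} \<and> R \<in> A)"
        using XY(2) assms(2) by auto
      then obtain R' i' where R': "R' \<in> \<P>" "Y = R' \<and> R' \<notin> A \<or> Y = {x\<in>R'. pt x = i'} \<and> R' \<in> A" by blast
      show "disjnt X Y"
      proof (cases "R = R'")
        case True
        then show ?thesis using R R' XY(3) by (auto simp: disjnt_def)
      next
        case False
        then have "disjnt R R'" using dis R(1) R'(1) by (auto simp: pairwise_def)
        then show ?thesis using R R' by (auto simp: disjnt_def)
      qed
    qed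
    show "\<Union>(\<P> - A \<union> ?C) \<subseteq> {1..k}" using fin assms(2) by auto
    show "g \<subseteq> \<Union>(\<P> - A \<union> ?C) \<and> card g \<le> n" if "g \<in> consistent \<P> f" for g
    proof
      have "\<Union>\<P> \<subseteq> \<Union>(\<P> - A \<union> ?C)"
      proof
        fix x assume "x \<in> \<Union>\<P>"
        then obtain R where R: "R \<in> \<P>" "x \<in> R" by blast
        show "x \<in> \<Union>(\<P> - A \<union> ?C)"
        proof (cases "R \<in> A")
          case True
          then have "{y\<in>R. pt y = pt x} \<in> ?C" using assms(3)[of x] R by auto
          then show ?thesis using R by blast
        qed (use R in auto)
      qed
      moreover have "g \<subseteq> \<Union>\<P>" using that by (simp add: consistent_def)
      ultimately show "g \<subseteq> \<Union>(\<P> - A \<union> ?C)" by (rule subset_trans[rotated])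
      show "card g \<le> n"
        using position_consistent(1)[OF assms(1) that] by (simp add: position_def)
    qed
    show "solvable t (consistent \<P>' h)"
      if "h \<in> consistent \<P> f" "position \<P>' h" "\<P>' \<subseteq> \<P> - A \<union> ?C" for \<P>' h
      using that(3) by (intro assms(5)[OF that(2,1)]) auto
  qed
qed

text \<open>Every region of a position contains a coin, so a region with one element is a coin and
  nothing is left to ask.\<close>

lemma solvable_singletons:
  assumes "position \<P> f" "\<And>R. R \<in> \<P> \<Longrightarrow> card R \<le> 1"
  shows "solvable 0 (consistent \<P> f)"
proof -
  have "g = \<Union>\<P>" if "g \<in> consistent \<P> f" for g
  proof (rule equalityI)
    show "g \<subseteq> \<Union>\<P>" using that unfolding consistent_def by blast
    show "\<Union>\<P> \<subseteq> g"
    proof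
      fix x assume "x \<in> \<Union>\<P>"
      then obtain R where R: "R \<in> \<P>" "x \<in> R" by blast
      have "g \<inter> R \<noteq> {}" using position_consistent(1)[OF assms(1) that] R by (simp add: position_def)
      then obtain y where y: "y \<in> g" "y \<in> R" by blast
      have "x = y"
        using assms(2)[OF R(1)] position_finite(4)[OF assms(1) R(1)] R(2) y(2)
        by (metis card_le_Suc0_iff_eq One_nat_def)
      then show "x \<in> g" using y by simp
    qed
  qed
  then show ?thesis by auto
qed

end

section \<open>Packing intervals and Lindstrom's weighing design\<close>

text \<open>Greedy: the next interval starts at the end of the occupied range, or at the next
  multiple of \<open>D\<close> if it would cross one. The gap skipped is shorter than the interval,
  hence the factor 2. Used twice: to lay out counts in words of \<open>D\<close> bits for the
  weighing design, and regions in batches for the pipeline.\<close>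

lemma ex_packing:
  fixes b :: "'a \<Rightarrow> nat"
  assumes "finite I" "0 < D" "\<And>i. i \<in> I \<Longrightarrow> b i \<le> D"
  shows "\<exists>pos. (\<forall>i\<in>I. pos i + b i \<le> 2 * sum b I \<and> pos i mod D + b i \<le> D) \<and>
    (\<forall>i\<in>I. \<forall>j\<in>I. i \<noteq> j \<longrightarrow> pos i + b i \<le> pos j \<or> pos j + b j \<le> pos i)"
  using assms(1,3)
proof (induction I rule: finite_induct)
  case (insert x I)
  then obtain pos where pos: "\<And>i. i \<in> I \<Longrightarrow> pos i + b i \<le> 2 * sum b I"
    "\<And>i. i \<in> I \<Longrightarrow> pos i mod D + b i \<le> D"
    "\<And>i j. i \<in> I \<Longrightarrow> j \<in> I \<Longrightarrow> i \<noteq> j \<Longrightarrow> pos i + b i \<le> pos j \<or> pos j + b j \<le> pos i"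
    by force
  let ?p = "2 * sum b I"
  obtain p where p: "?p \<le> p" "p + b x \<le> ?p + 2 * b x" "p mod D + b x \<le> D"
  proof (cases "?p mod D + b x \<le> D")
    case True
    then show ?thesis by (intro that[of ?p]) auto
  next
    case False
    have *: "?p div D * D + ?p mod D = ?p" by (rule div_mult_mod_eq)
    have "?p mod D < D" using assms(2) by simp
    then have "?p \<le> ?p div D * D + D" "?p div D * D + D \<le> ?p + b x"
      using False * by linarith+
    then show ?thesis
      using insert.prems[of x] by (intro that[of "?p div D * D + D"]) simp_all
  qed
  have "(pos(x := p)) i + b i \<le> 2 * sum b (insert x I) \<and> (pos(x := p)) i mod D + b i \<le> D"
    if "i \<in> insert x I" for i
    using that pos(1,2)[of i] p insert.hyps by (cases "i = x") auto
  moreover have "(pos(x := p)) i + b i \<le> (pos(x := p)) j \<or> (pos(x := p)) j + b j \<le> (pos(x := p)) i"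
    if "i \<in> insert x I" "j \<in> insert x I" "i \<noteq> j" for i j
    using that pos(1)[of i] pos(1)[of j] pos(3)[of i j] p(1) by (cases "i = x"; cases "j = x") auto
  ultimately show ?case by (intro exI[of _ "pos(x := p)"]) blast
qed simp

text \<open>Greedy: the first multiple \<open>y\<close> of \<open>2 ^ e\<close> after the total
  \<open>m\<close> of the earlier sizes is at most \<open>m + 2 ^ e\<close>, which the new size pays
  for. Slot \<open>y - 1\<close> is new because the earlier slots lie below
  \<open>m\<close>.\<close>

lemma ex_dyadic_slots:
  fixes s :: "'a \<Rightarrow> nat"
  assumes "finite I" "\<And>i. i \<in> I \<Longrightarrow> 1 \<le> s i"
  shows "\<exists>J. inj_on J I \<and> (\<forall>i\<in>I. J i < sum s I \<and>
    (\<exists>e. 2 ^ e \<le> s i \<and> s i < 2 ^ Suc e \<and> 2 ^ e dvd Suc (J i)))"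
  using assms
proof (induction I rule: finite_induct)
  case (insert x I)
  then obtain J where J: "inj_on J I" "\<And>i. i \<in> I \<Longrightarrow> J i < sum s I"
    "\<And>i. i \<in> I \<Longrightarrow> \<exists>e. 2 ^ e \<le> s i \<and> s i < 2 ^ Suc e \<and> 2 ^ e dvd Suc (J i)"
    by force
  obtain e where e: "2 ^ e \<le> s x" "s x < 2 ^ Suc e"
    using ex_power_ivl1[of 2 "s x"] insert.prems[of x] by auto
  let ?m = "sum s I"
  define y where "y = (?m div 2 ^ e + 1) * 2 ^ e"
  have "?m div 2 ^ e * 2 ^ e + ?m mod 2 ^ e = ?m" "?m mod 2 ^ e < 2 ^ e"
    by (rule div_mult_mod_eq) simp
  moreover have "y = ?m div 2 ^ e * 2 ^ e + 2 ^ e"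
    by (simp add: y_def)
  ultimately have y: "?m < y" "y \<le> ?m + s x" "2 ^ e dvd y"
    using e(1) by (linarith, linarith, simp add: y_def)
  let ?J = "J(x := y - 1)"
  have "inj_on ?J (insert x I)"
  proof (rule inj_onI)
    fix i j assume "i \<in> insert x I" "j \<in> insert x I" "?J i = ?J j"
    then show "i = j"
      using J(2)[of i] J(2)[of j] y(1) inj_onD[OF J(1), of i j]
      by (cases "i = x"; cases "j = x") auto
  qed
  moreover have "?J i < sum s (insert x I) \<and>
    (\<exists>e. 2 ^ e \<le> s i \<and> s i < 2 ^ Suc e \<and> 2 ^ e dvd Suc (?J i))" if "i \<in> insert x I" for i
  proof (cases "i = x")
    case True
    then show ?thesis using y e insert.hyps by (auto intro!: exI[of _ e])
  next
    case False
    then show ?thesis using that J(2,3)[of i] insert.hyps by auto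
  qed
  ultimately show ?case by blast
qed simp

lemma sum_intervals_le:
  fixes s pos :: "'a \<Rightarrow> nat"
  assumes "finite I" "\<And>i. i \<in> I \<Longrightarrow> a \<le> pos i \<and> pos i + s i \<le> a + D"
    "\<And>i j. i \<in> I \<Longrightarrow> j \<in> I \<Longrightarrow> i \<noteq> j \<Longrightarrow> pos i + s i \<le> pos j \<or> pos j + s j \<le> pos i"
  shows "sum s I \<le> D"
proof -
  have "card (\<Union>i\<in>I. {pos i..<pos i + s i}) = (\<Sum>i\<in>I. card {pos i..<pos i + s i})"
    using assms(1,3) by (intro card_UN_disjoint) fastforce+
  then have "sum s I = card (\<Union>i\<in>I. {pos i..<pos i + s i})"
    by simp
  also have "\<dots> \<le> card {a..<a + D}"
    using assms(2) by (intro card_mono) fastforce+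
  finally show ?thesis by simp
qed

text \<open>Among the non-zero digits take the one with least position \<open>p m\<close>. The other
  terms are multiples of \<open>2 ^ (p m + b m)\<close>, hence so is
  \<open>\<delta> m * 2 ^ p m\<close>, whose absolute value is too small for that.\<close>

lemma disjoint_radix_zero:
  fixes \<delta> :: "'a \<Rightarrow> int"
  assumes "finite I" "\<And>i. i \<in> I \<Longrightarrow> \<bar>\<delta> i\<bar> < 2 ^ b i"
    "\<And>i j. i \<in> I \<Longrightarrow> j \<in> I \<Longrightarrow> i \<noteq> j \<Longrightarrow> p i + b i \<le> p j \<or> p j + b j \<le> p i"
    "(\<Sum>i\<in>I. \<delta> i * 2 ^ p i) = 0"
    "i \<in> I"
  shows "\<delta> i = 0"
proof (rule ccontr)
  assume "\<delta> i \<noteq> 0"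
  define K where "K = {i\<in>I. \<delta> i \<noteq> 0}"
  have "finite K" "K \<noteq> {}" using assms(1,5) \<open>\<delta> i \<noteq> 0\<close> by (auto simp: K_def)
  then obtain m where m: "m \<in> K" "\<And>j. j \<in> K \<Longrightarrow> p m \<le> p j"
    by (metis arg_min_if_finite(1) arg_min_least)
  have later: "p m + b m \<le> p j" if "j \<in> K - {m}" for j
  proof -
    \<comment> \<open>An empty window might start at \<open>p m\<close> itself and would then not be
      forced behind the window of \<open>m\<close>.\<close>
    have "b j \<noteq> 0"
    proof
      assume "b j = 0"
      then have "\<delta> j = 0" using assms(2)[of j] that by (auto simp: K_def)
      then show False using that by (simp add: K_def)
    qed
    then show ?thesis using assms(3)[of m j] m that by (force simp: K_def)
  qed
  have "(\<Sum>i\<in>K. \<delta> i * 2 ^ p i) = 0"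
    using assms(1,4) by (subst sum.mono_neutral_left[of I]) (auto simp: K_def)
  then have "\<delta> m * 2 ^ p m = - (\<Sum>i\<in>K - {m}. \<delta> i * 2 ^ p i)"
    using \<open>finite K\<close> m(1) by (simp add: sum.remove)
  also have "2 ^ (p m + b m) dvd \<dots>"
    using later by (auto intro!: dvd_sum dvd_mult le_imp_power_dvd)
  finally have "(2::int) ^ b m * 2 ^ p m dvd \<delta> m * 2 ^ p m"
    by (simp add: power_add mult.commute)
  then have "(2::int) ^ b m dvd \<delta> m"
    by simp
  then have "\<delta> m = 0"
    using assms(2)[of m] m(1) zdvd_imp_le[of "2 ^ b m" "\<bar>\<delta> m\<bar>"] by (fastforce simp: K_def)
  then show False using m(1) by (simp add: K_def)
qed

section \<open>Alternating sums over subsets, and subsets of even size\<close>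

lemma sum_Pow_insert:
  assumes "finite A" "x \<notin> A"
  shows "(\<Sum>q\<in>Pow (insert x A). \<phi> q) = (\<Sum>q\<in>Pow A. \<phi> q) + (\<Sum>q\<in>Pow A. \<phi> (insert x q))"
proof -
  have "inj_on (insert x) (Pow A)"
    using assms(2) by (fastforce simp: inj_on_def)
  moreover have "Pow A \<inter> insert x ` Pow A = {}" using assms(2) by auto
  ultimately show ?thesis
    using assms(1) by (simp add: Pow_insert sum.union_disjoint sum.reindex)
qed

text \<open>Subsets with and without \<open>x\<close> pair off, with equal values of
  \<open>\<phi>\<close> and opposite signs.\<close>

lemma alternating_sum_zero:
  fixes \<phi> :: "'a set \<Rightarrow> int"
  assumes "finite S" "x \<in> S" "\<And>q. \<phi> (insert x q) = \<phi> q"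
  shows "(\<Sum>q\<in>Pow S. (- 1) ^ card q * \<phi> q) = 0"
proof -
  have S: "insert x (S - {x}) = S" using assms(2) by auto
  have fin: "finite (S - {x})" using assms(1) by simp
  have "card (insert x q) = Suc (card q)" if "q \<in> Pow (S - {x})" for q
    using that fin by (intro card_insert_disjoint) (auto intro: finite_subset)
  then show ?thesis
    using sum_Pow_insert[OF fin, of x "\<lambda>q. (- 1) ^ card q * \<phi> q"] S assms(3)
    by (simp add: sum_negf)
qed

text \<open>Adding \<open>x\<close> where necessary makes every subset of \<open>T - {x}\<close>
  even, so there are \<open>2 ^ (card T - 1)\<close> even sets to choose from.\<close>

lemma ex_even_subsets:
  assumes "finite T" "m < card T"
  shows "\<exists>G. G \<subseteq> Pow T \<and> (\<forall>q\<in>G. even (card q)) \<and> card G = 2 ^ m"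
proof -
  obtain x where x: "x \<in> T" using assms by force
  define \<psi> where "\<psi> q = (if even (card q) then q else insert x q)" for q
  have fin: "finite q" if "q \<in> Pow (T - {x})" for q
    using that assms(1) by (auto intro: finite_subset)
  have "\<psi> q - {x} = q" if "q \<in> Pow (T - {x})" for q
    using that by (auto simp: \<psi>_def)
  then have "inj_on \<psi> (Pow (T - {x}))"
    by (rule inj_on_inverseI[where g = "\<lambda>q. q - {x}"])
  then have "card (\<psi> ` Pow (T - {x})) = 2 ^ (card T - 1)"
    using x assms(1) by (simp add: card_image card_Pow)
  moreover have "(2::nat) ^ m \<le> 2 ^ (card T - 1)"
    using assms(2) by (intro power_increasing) auto
  ultimately obtain G where G: "G \<subseteq> \<psi> ` Pow (T - {x})" "card G = 2 ^ m"
    by (metis obtain_subset_with_card_n)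
  have "\<psi> q \<subseteq> T \<and> even (card (\<psi> q))" if "q \<in> Pow (T - {x})" for q
    using that x fin[OF that] by (auto simp: \<psi>_def card_insert_if)
  then have "q \<subseteq> T \<and> even (card q)" if "q \<in> G" for q
    using G(1) that by (metis imageE subsetD)
  then show ?thesis using G(2) by (intro exI[of _ G]) auto
qed

text \<open>Of \<open>T\<close> and its complement one has at least \<open>D + 1\<close> elements.
  Index sets of this size have enough even subsets for all weights up to \<open>2 ^ (D - 1)\<close>,
  so that each of them can carry a word of \<open>D\<close> bits.\<close>

lemma card_large_subsets:
  "4 ^ D \<le> card {T. T \<subseteq> {..<2 * D + 1} \<and> D + 1 \<le> card T}"
proof -
  let ?U = "{..<2 * D + 1}"
  let ?A = "{T. T \<subseteq> ?U \<and> D + 1 \<le> card T}"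
  have fin: "finite ?A" by simp
  have "Pow ?U \<subseteq> ?A \<union> (\<lambda>T. ?U - T) ` ?A"
  proof
    fix T assume T: "T \<in> Pow ?U"
    show "T \<in> ?A \<union> (\<lambda>T. ?U - T) ` ?A"
    proof (cases "D + 1 \<le> card T")
      case False
      have "card (?U - T) = 2 * D + 1 - card T"
        using T by (simp add: card_Diff_subset finite_subset)
      then have "?U - T \<in> ?A" using False by auto
      moreover have "T = ?U - (?U - T)" using T by auto
      ultimately show ?thesis by blast
    qed (use T in auto)
  qed
  then have "card (Pow ?U) \<le> card (?A \<union> (\<lambda>T. ?U - T) ` ?A)"
    using fin by (intro card_mono) auto
  also have "\<dots> \<le> card ?A + card ((\<lambda>T. ?U - T) ` ?A)"
    by (rule card_Un_le)
  also have "\<dots> \<le> 2 * card ?A"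
    using card_image_le[OF fin, of "\<lambda>T. ?U - T"] by simp
  finally show ?thesis
    by (simp add: card_Pow power_mult)
qed

text \<open>Lindstrom's weighing design. The alternating sum over the rows \<open>q \<subseteq> S\<close> kills every unknown
  whose index set does not contain \<open>S\<close>, and counts an unknown with index set \<open>S\<close> exactly
  \<open>2 ^ p\<close> times, so that the unknowns can be read off by descending induction on the index sets.\<close>

lemma weighing_design_injective:
  fixes c c' :: "'a \<Rightarrow> nat" and T :: "'a \<Rightarrow> 'b set"
  assumes "finite I" "finite U"
    and T: "\<And>i. i \<in> I \<Longrightarrow> T i \<subseteq> U"
    and G: "\<And>i. i \<in> I \<Longrightarrow> G i \<subseteq> Pow (T i)" "\<And>i q. i \<in> I \<Longrightarrow> q \<in> G i \<Longrightarrow> even (card q)"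
      "\<And>i. i \<in> I \<Longrightarrow> card (G i) = 2 ^ p i"
    and bound: "\<And>i. i \<in> I \<Longrightarrow> c i < 2 ^ b i" "\<And>i. i \<in> I \<Longrightarrow> c' i < 2 ^ b i"
    and disj: "\<And>i j. i \<in> I \<Longrightarrow> j \<in> I \<Longrightarrow> i \<noteq> j \<Longrightarrow> T i = T j \<Longrightarrow>
      p i + b i \<le> p j \<or> p j + b j \<le> p i"
    and eq: "\<And>q. q \<subseteq> U \<Longrightarrow> (\<Sum>i | i \<in> I \<and> q \<inter> T i \<in> G i. c i) = (\<Sum>i | i \<in> I \<and> q \<inter> T i \<in> G i. c' i)"
    and "i \<in> I"
  shows "c i = c' i"
proof -
  define \<delta> where "\<delta> i = int (c i) - int (c' i)" for i
  define \<chi> where "\<chi> i q = (if q \<inter> T i \<in> G i then 1 else 0 :: int)" for i q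
  have row: "(\<Sum>i\<in>I. \<delta> i * \<chi> i q) = 0" if "q \<subseteq> U" for q
  proof -
    have "(\<Sum>i\<in>I. \<delta> i * \<chi> i q) = (\<Sum>i | i \<in> I \<and> q \<inter> T i \<in> G i. \<delta> i)"
      using assms(1) by (intro sum.mono_neutral_cong_right) (auto simp: \<chi>_def)
    also have "\<dots> = int (\<Sum>i | i \<in> I \<and> q \<inter> T i \<in> G i. c i) - int (\<Sum>i | i \<in> I \<and> q \<inter> T i \<in> G i. c' i)"
      by (simp add: \<delta>_def sum_subtractf)
    finally show ?thesis using eq[OF that] by simp
  qed
  define alt where "alt S i = (\<Sum>q\<in>Pow S. (- 1) ^ card q * \<chi> i q)" for S i
  have alt_sum: "(\<Sum>i\<in>I. \<delta> i * alt S i) = 0" if "S \<subseteq> U" for S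
  proof -
    have "(\<Sum>i\<in>I. \<delta> i * alt S i) = (\<Sum>q\<in>Pow S. (- 1) ^ card q * (\<Sum>i\<in>I. \<delta> i * \<chi> i q))"
      unfolding alt_def sum_distrib_left by (subst sum.swap) (simp add: algebra_simps)
    also have "\<dots> = 0" using that row by (intro sum.neutral) auto
    finally show ?thesis .
  qed
  have alt_zero: "alt S i = 0" if "S \<subseteq> U" "\<not> S \<subseteq> T i" for S i
  proof -
    obtain x where x: "x \<in> S" "x \<notin> T i" using \<open>\<not> S \<subseteq> T i\<close> by blast
    have "\<chi> i (insert x q) = \<chi> i q" for q using x(2) by (simp add: \<chi>_def)
    then show ?thesis
      unfolding alt_def using that(1) assms(2) x(1) by (intro alternating_sum_zero) (auto intro: finite_subset)
  qed
  \<comment> \<open>All sets in \<open>G i\<close> are even, so no sign survives and the sum counts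
    \<open>G i\<close>.\<close>
  have alt_self: "alt (T i) i = 2 ^ p i" if i: "i \<in> I" for i
  proof -
    have "alt (T i) i = (\<Sum>q\<in>G i. 1)"
      unfolding alt_def using G(1,2)[OF i] finite_subset[OF T[OF i] assms(2)]
      by (intro sum.mono_neutral_cong_right) (auto simp: \<chi>_def Int_absorb2)
    then show ?thesis using G(3)[OF i] by simp
  qed
  have "\<delta> i = 0" using \<open>i \<in> I\<close>
  proof (induction "card U - card (T i)" arbitrary: i rule: less_induct)
    case less
    let ?S = "T i"
    \<comment> \<open>A proper superset \<open>T j\<close> of \<open>?S\<close> is settled by
      induction; a \<open>T j\<close> that does not contain \<open>?S\<close> is killed by the
      alternating sum.\<close>
    have "\<delta> j * alt ?S j = (if T j = ?S then \<delta> j * 2 ^ p j else 0)" if j: "j \<in> I" for j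
    proof (cases "?S \<subseteq> T j")
      case True
      show ?thesis
      proof (cases "T j = ?S")
        case True
        then show ?thesis using alt_self[OF j] by simp
      next
        case False
        then have "card ?S < card (T j)"
          using True T[OF j] assms(2) by (intro psubset_card_mono) (auto intro: finite_subset)
        moreover have "card (T j) \<le> card U"
          using T[OF j] assms(2) by (rule card_mono[rotated])
        ultimately have "\<delta> j = 0" using j by (intro less.hyps) auto
        then show ?thesis by simp
      qed
    next
      case False
      then show ?thesis using alt_zero[OF T[OF less.prems]] by auto
    qed
    then have "(\<Sum>j\<in>I. if T j = ?S then \<delta> j * 2 ^ p j else 0) = 0"
      using alt_sum[OF T[OF less.prems]] by simp
    \<comment> \<open>Unknowns sharing an index set enter one equation as digits at the positions
      \<open>p j\<close>; their disjoint windows separate them.\<close>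
    then have "(\<Sum>j | j \<in> I \<and> T j = ?S. \<delta> j * 2 ^ p j) = 0"
      using assms(1) by (simp add: sum.inter_filter)
    moreover have "\<bar>\<delta> j\<bar> < 2 ^ b j" if "j \<in> I" for j
    proof -
      have "int (c j) < int (2 ^ b j)" "int (c' j) < int (2 ^ b j)"
        using bound[OF that] by (simp_all only: of_nat_less_iff)
      then have "int (c j) < 2 ^ b j" "int (c' j) < 2 ^ b j"
        by simp_all
      then show ?thesis unfolding \<delta>_def by linarith
    qed
    ultimately show ?case
      using assms(1) less.prems disj
      by (intro disjoint_radix_zero[of "{j\<in>I. T j = ?S}" \<delta> b p i]) auto
  qed
  then show ?thesis by (simp add: \<delta>_def)
qed

section \<open>The signed tree of Cantor and Mills\<close>

text \<open>Node \<open>v\<close> combines the rows of its children \<open>2 * v\<close> and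
  \<open>2 * v + 1\<close>: rows \<open>2 * j\<close> and \<open>2 * j + 1\<close> are the sum and
  the difference of the children's rows \<open>j\<close>, and the content \<open>c\<close> of slot
  \<open>j\<close> rides on the difference. The two rows add up to \<open>2 * a + c\<close>, so the
  parity of \<open>c\<close> shows while \<open>a\<close> and \<open>b\<close> are unknown; this is
  the Cantor-Mills recursion.\<close>

fun tree_row :: "nat \<Rightarrow> nat \<Rightarrow> (nat \<Rightarrow> nat \<Rightarrow> nat \<Rightarrow> int) \<Rightarrow> nat \<Rightarrow> int" where
  "tree_row 0 v c q = 0"
| "tree_row (Suc h) v c q =
    (let a = tree_row h (2 * v) c (q div 2); b = tree_row h (2 * v + 1) c (q div 2)
     in if even q then a + b else a - b + c (Suc h) v (q div 2))"

text \<open>Slot \<open>j\<close> holds any number below \<open>2 ^ (v + 1)\<close>, where \<open>2 ^ v\<close> is the largest power of \<open>2\<close>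
  dividing \<open>j + 1\<close>; a fraction of about \<open>1/s\<close> of the slots thus has room for a region of \<open>s\<close> coins.\<close>

definition fits :: "nat \<Rightarrow> int \<Rightarrow> bool" where
  "fits j d \<longleftrightarrow> 0 \<le> d \<and> (\<exists>e. 2 ^ e dvd Suc j \<and> d < 2 ^ Suc e)"

text \<open>Left children, which have even numbers, are kept empty so that they can absorb the carry
  from their parents. The root, node 0, is empty as well.\<close>

definition admissible_load :: "(nat \<Rightarrow> nat \<Rightarrow> nat \<Rightarrow> int) \<Rightarrow> bool" where
  "admissible_load c \<longleftrightarrow> (\<forall>h v j. fits j (c h v j) \<and> (even v \<longrightarrow> c h v j = 0))"

lemma fits_even:
  assumes "fits (2 * j) d"
  shows "d div 2 = 0"
proof -
  obtain e where e: "0 \<le> d" "2 ^ e dvd Suc (2 * j)" "d < 2 ^ Suc e"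
    using assms by (auto simp: fits_def)
  have "e = 0"
  proof (rule ccontr)
    assume "e \<noteq> 0"
    then have "(2::nat) dvd 2 ^ e" by simp
    then have "2 dvd Suc (2 * j)" using e(2) by (rule dvd_trans)
    then show False by simp
  qed
  then show ?thesis using e by simp
qed

text \<open>\<open>Suc (2 * j + 1) = 2 * Suc j\<close>, so halving the content makes up for the lost
  factor 2 and the carry fits one level down.\<close>

lemma fits_odd:
  assumes "fits (2 * j + 1) d"
  shows "fits j (d div 2)"
proof -
  obtain e where e: "0 \<le> d" "2 ^ e dvd 2 * Suc j" "d < 2 ^ Suc e"
    using assms by (auto simp: fits_def)
  show ?thesis
  proof (cases e)
    case 0
    then show ?thesis using e by (auto simp: fits_def intro!: exI[of _ 0])
  next
    case (Suc e')
    have "2 ^ e' dvd Suc j"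
      using e(2) unfolding Suc power_Suc by (simp only: nat_mult_dvd_cancel_disj) simp
    then show ?thesis using e(1,3) Suc by (auto simp: fits_def intro!: exI[of _ e'])
  qed
qed

text \<open>The parity of \<open>d\<close> is visible at once; what remains of \<open>d\<close> after halving is carried one
  level down along the left spine, where the slots are unused because \<open>v\<close> is even.\<close>

lemma tree_row_carry:
  assumes "admissible_load c" "admissible_load c'" "even v"
    "\<And>j. j < 2 ^ h \<Longrightarrow> fits j (d j)" "\<And>j. j < 2 ^ h \<Longrightarrow> fits j (d' j)"
    "\<And>j. j < 2 ^ h \<Longrightarrow> 2 * tree_row h v c j + d j = 2 * tree_row h v c' j + d' j"
    "j < 2 ^ h"
  shows "d j = d' j"
  using assms(3-)
proof (induction h arbitrary: v d d' j)
  case 0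
  then show ?case by simp
next
  case (Suc h)
  have zero: "c (Suc h) v i = 0" "c' (Suc h) v i = 0" for i
    using assms(1,2) Suc.prems(1) by (auto simp: admissible_load_def)
  define r where "r = tree_row (Suc h) v c"
  define r' where "r' = tree_row (Suc h) v c'"
  have eq: "2 * r i + d i = 2 * r' i + d' i" if "i < 2 ^ Suc h" for i
    using Suc.prems(4)[OF that] by (simp add: r_def r'_def del: tree_row.simps)
  have par: "d i mod 2 = d' i mod 2" if "i < 2 ^ Suc h" for i
    using eq[OF that] by presburger
  have half: "r i + d i div 2 = r' i + d' i div 2" if "i < 2 ^ Suc h" for i
    using eq[OF that] by presburger
  \<comment> \<open>Nothing is carried from slot \<open>2 * i\<close>. As the node is empty, rows
    \<open>2 * i\<close> and \<open>2 * i + 1\<close> add up to twice row \<open>i\<close> of the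
    left child; with the carry from slot \<open>2 * i + 1\<close> this is the same problem one level
    down.\<close>
  have odd: "d (2 * i + 1) div 2 = d' (2 * i + 1) div 2" if i: "i < 2 ^ h" for i
  proof (rule Suc.IH[of "2 * v" "\<lambda>i. d (2 * i + 1) div 2" "\<lambda>i. d' (2 * i + 1) div 2" i])
    fix i :: nat assume i: "i < 2 ^ h"
    then have i2: "2 * i < 2 ^ Suc h" "2 * i + 1 < 2 ^ Suc h" by auto
    show "fits i (d (2 * i + 1) div 2)" "fits i (d' (2 * i + 1) div 2)"
      using Suc.prems(2,3)[OF i2(2)] by (simp_all add: fits_odd)
    have "r (2 * i) = r' (2 * i)"
      using half[OF i2(1)] fits_even[OF Suc.prems(2)[OF i2(1)]] fits_even[OF Suc.prems(3)[OF i2(1)]]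
      by simp
    moreover have "r (2 * i) + r (2 * i + 1) = 2 * tree_row h (2 * v) c i"
      "r' (2 * i) + r' (2 * i + 1) = 2 * tree_row h (2 * v) c' i"
      using zero by (simp_all add: r_def r'_def Let_def)
    ultimately show "2 * tree_row h (2 * v) c i + d (2 * i + 1) div 2 =
        2 * tree_row h (2 * v) c' i + d' (2 * i + 1) div 2"
      using half[OF i2(2)] by linarith
  qed (use i in auto)
  have "d j div 2 = d' j div 2"
  proof (cases "even j")
    case True
    then obtain i where "j = 2 * i" by blast
    then show ?thesis
      using fits_even[of i "d j"] fits_even[of i "d' j"] Suc.prems(2,3)[OF Suc.prems(5)] by simp
  next
    case False
    then obtain i where "j = 2 * i + 1" by (rule oddE)
    then show ?thesis using odd[of i] Suc.prems(5) by simp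
  qed
  then show ?case using par[OF Suc.prems(5)] by (metis div_mult_mod_eq)
qed

lemma div_power_Suc_diff:
  assumes "h' \<le> (h::nat)"
  shows "(x::nat) div 2 ^ (h - h') div 2 = x div 2 ^ (Suc h - h')"
    "x div 2 div 2 ^ (h - h') = x div 2 ^ (Suc h - h')"
  using assms div_mult2_eq[of x "2 ^ (h - h')" 2] div_mult2_eq[of x 2 "2 ^ (h - h')"]
  by (simp_all add: Suc_diff_le mult.commute)

text \<open>A pair of rows adds up to \<open>2 * a + c\<close> with \<open>a\<close> a row of the
  left child, from which \<open>tree_row_carry\<close> extracts \<open>c\<close>. Then sum and
  difference give \<open>a\<close> and \<open>b\<close>, and the argument descends into both
  children. The condition on \<open>u\<close> makes it a descendant of \<open>v\<close>, or
  \<open>v\<close> itself.\<close>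

lemma tree_row_injective:
  assumes "admissible_load c" "admissible_load c'"
    "\<And>q. q < 2 ^ h \<Longrightarrow> tree_row h v c q = tree_row h v c' q"
    "1 \<le> h'" "h' \<le> h" "u div 2 ^ (h - h') = v" "j < 2 ^ (h' - 1)"
  shows "c h' u j = c' h' u j"
  using assms(3-)
proof (induction h arbitrary: v)
  case 0
  then show ?case by simp
next
  case (Suc h)
  have row: "tree_row h (2 * v) c i + tree_row h (2 * v + 1) c i =
      tree_row h (2 * v) c' i + tree_row h (2 * v + 1) c' i"
    "tree_row h (2 * v) c i - tree_row h (2 * v + 1) c i + c (Suc h) v i =
      tree_row h (2 * v) c' i - tree_row h (2 * v + 1) c' i + c' (Suc h) v i"
    if "i < 2 ^ h" for i
    using Suc.prems(1)[of "2 * i"] Suc.prems(1)[of "2 * i + 1"] that by (simp_all add: Let_def)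
  have c: "c (Suc h) v i = c' (Suc h) v i" if "i < 2 ^ h" for i
  proof (rule tree_row_carry[OF assms(1,2), of "2 * v" h "c (Suc h) v" "c' (Suc h) v" i])
    fix i :: nat assume "i < 2 ^ h"
    from row[OF this] show "2 * tree_row h (2 * v) c i + c (Suc h) v i =
        2 * tree_row h (2 * v) c' i + c' (Suc h) v i"
      by linarith
  qed (use assms(1,2) that in \<open>auto simp: admissible_load_def\<close>)
  have a: "tree_row h (2 * v) c i = tree_row h (2 * v) c' i"
    and b: "tree_row h (2 * v + 1) c i = tree_row h (2 * v + 1) c' i" if "i < 2 ^ h" for i
    using row[OF that] c[OF that] by linarith+
  show ?case
  proof (cases "h' = Suc h")
    case True
    then show ?thesis using c[of j] Suc.prems by simp
  next
    case False
    then have h': "h' \<le> h" using Suc.prems by simp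
    then have "u div 2 ^ (h - h') div 2 = v"
      using Suc.prems(4) div_power_Suc_diff(1)[OF h'] by simp
    then have "u div 2 ^ (h - h') = 2 * v \<or> u div 2 ^ (h - h') = 2 * v + 1"
      by linarith
    then show ?thesis
      using Suc.IH[of "2 * v"] Suc.IH[of "2 * v + 1"] a b Suc.prems(2,5) h' by blast
  qed
qed

section \<open>Coefficients of the tree rows and their support\<close>

fun tree_sign :: "nat \<Rightarrow> nat \<Rightarrow> nat \<Rightarrow> nat \<times> nat \<times> nat \<Rightarrow> int" where
  "tree_sign 0 v q \<sigma> = 0"
| "tree_sign (Suc h) v q \<sigma> =
    tree_sign h (2 * v) (q div 2) \<sigma> + (- 1) ^ q * tree_sign h (2 * v + 1) (q div 2) \<sigma> +
    (if odd q \<and> \<sigma> = (Suc h, v, q div 2) then 1 else 0)"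

lemma tree_row_eq_sum:
  assumes "finite X"
  shows "tree_row h v (\<lambda>h u j. int (card {x\<in>X. sl x = (h, u, j)})) q = (\<Sum>x\<in>X. tree_sign h v q (sl x))"
proof (induction h arbitrary: v q)
  case (Suc h)
  have card: "int (card {x\<in>X. sl x = \<sigma>}) = (\<Sum>x\<in>X. if sl x = \<sigma> then 1 else 0)" for \<sigma>
    using assms by (simp add: sum.inter_filter[symmetric])
  show ?case
    by (auto simp: Let_def Suc[unfolded card] card sum.distrib sum_negf sum_subtractf)
qed simp

lemma tree_sign_support:
  assumes "tree_sign h v q (h', u, j) \<noteq> 0"
  shows "h' \<le> h \<and> u div 2 ^ (h - h') = v \<and> q div 2 ^ (h - h') = 2 * j + 1"
  using assms
proof (induction h arbitrary: v q)
  case (Suc h)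
  have shift: "h' \<le> Suc h \<and> u div 2 ^ (Suc h - h') = v \<and> q div 2 ^ (Suc h - h') = 2 * j + 1"
    if "h' \<le> h \<and> u div 2 ^ (h - h') = w \<and> q div 2 div 2 ^ (h - h') = 2 * j + 1" "w div 2 = v" for w
  proof -
    have "u div 2 ^ (h - h') div 2 = u div 2 ^ (Suc h - h')"
      "q div 2 div 2 ^ (h - h') = q div 2 ^ (Suc h - h')"
      using that(1) div_power_Suc_diff by auto
    then show ?thesis using that by auto
  qed
  consider "tree_sign h (2 * v) (q div 2) (h', u, j) \<noteq> 0"
    | "tree_sign h (2 * v + 1) (q div 2) (h', u, j) \<noteq> 0"
    | "odd q" "(h', u, j) = (Suc h, v, q div 2)"
    using Suc.prems by (cases "tree_sign h (2 * v) (q div 2) (h', u, j) = 0";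
      cases "tree_sign h (2 * v + 1) (q div 2) (h', u, j) = 0") (auto split: if_splits)
  then show ?case
  proof cases
    case 1
    then show ?thesis using shift[OF Suc.IH[OF 1]] by simp
  next
    case 2
    then show ?thesis using shift[OF Suc.IH[OF 2]] by simp
  next
    case 3
    then show ?thesis by (auto simp: odd_two_times_div_two_succ)
  qed
qed simp

text \<open>A slot lies in the subtree of at most one child, and a slot of the node itself in
  neither, so at most one term of the recursion is non-zero.\<close>

lemma tree_sign_cases:
  "tree_sign h v q \<sigma> \<in> {- 1, 0, 1}"
proof (induction h arbitrary: v q)
  case (Suc h)
  obtain h' u j where \<sigma>: "\<sigma> = (h', u, j)" by (cases \<sigma>)
  let ?a = "tree_sign h (2 * v) (q div 2) \<sigma>" and ?b = "tree_sign h (2 * v + 1) (q div 2) \<sigma>"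
  have "?a = 0 \<or> ?b = 0"
    using tree_sign_support[of h "2 * v" "q div 2" h' u j]
      tree_sign_support[of h "2 * v + 1" "q div 2" h' u j] \<sigma> by (cases "?a = 0") auto
  moreover have "?a = 0 \<and> ?b = 0" if "h' = Suc h"
    using that tree_sign_support[of h "2 * v" "q div 2" h' u j]
      tree_sign_support[of h "2 * v + 1" "q div 2" h' u j] \<sigma> by force
  moreover have "?a \<in> {- 1, 0, 1}" "?b \<in> {- 1, 0, 1}" by (rule Suc)+
  ultimately show ?case
    using \<sigma> by (cases "even q") auto
qed simp

text \<open>A slot at height \<open>h'\<close> occurs only in rows with a fixed value of
  \<open>q div 2 ^ (h - h')\<close>. Few rows for high slots is what permits larger sets
  there.\<close>

lemma card_tree_sign_support:
  "card {q. q < 2 ^ h \<and> tree_sign h v q (h', u, j) \<noteq> 0} \<le> 2 ^ (h - h')"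
proof -
  let ?m = "2 ^ (h - h') :: nat"
  have "{q. q < 2 ^ h \<and> tree_sign h v q (h', u, j) \<noteq> 0} \<subseteq> {(2 * j + 1) * ?m..<(2 * j + 1) * ?m + ?m}"
  proof
    fix q assume "q \<in> {q. q < 2 ^ h \<and> tree_sign h v q (h', u, j) \<noteq> 0}"
    then have "q div ?m = 2 * j + 1" using tree_sign_support by blast
    moreover have "q div ?m * ?m + q mod ?m = q" "q mod ?m < ?m"
      by (rule div_mult_mod_eq) simp
    ultimately have "(2 * j + 1) * ?m + q mod ?m = q" "q mod ?m < ?m" by simp_all
    then show "q \<in> {(2 * j + 1) * ?m..<(2 * j + 1) * ?m + ?m}"
      unfolding atLeastLessThan_iff by linarith
  qed
  then have "card {q. q < 2 ^ h \<and> tree_sign h v q (h', u, j) \<noteq> 0} \<le>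
      card {(2 * j + 1) * ?m..<(2 * j + 1) * ?m + ?m}"
    by (intro card_mono) auto
  then show ?thesis by simp
qed

lemma sum_card_swap:
  assumes "finite A" "finite B"
  shows "(\<Sum>a\<in>A. card {b\<in>B. R a b}) = (\<Sum>b\<in>B. card {a\<in>A. R a b})"
proof -
  have "(\<Sum>a\<in>A. card {b\<in>B. R a b}) = (\<Sum>a\<in>A. \<Sum>b\<in>B. if R a b then 1 else 0)"
    using assms(2) by (simp add: sum.inter_filter[symmetric])
  also have "\<dots> = (\<Sum>b\<in>B. \<Sum>a\<in>A. if R a b then 1 else 0)"
    by (rule sum.swap)
  also have "\<dots> = (\<Sum>b\<in>B. card {a\<in>A. R a b})"
    using assms(1) by (simp add: sum.inter_filter[symmetric])
  finally show ?thesis .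
qed

lemma ex_common_cut:
  assumes "pairwise disjnt \<A>" "\<And>R. R \<in> \<A> \<Longrightarrow> finite R \<and> card R \<le> a * b R"
  shows "\<exists>pt :: 'a \<Rightarrow> nat. \<forall>R\<in>\<A>. (\<forall>x\<in>R. pt x < a) \<and> (\<forall>i. card {x\<in>R. pt x = i} \<le> b R)"
proof -
  have "\<forall>R\<in>\<A>. \<exists>pt :: 'a \<Rightarrow> nat. (\<forall>x\<in>R. pt x < a) \<and> (\<forall>i. card {x\<in>R. pt x = i} \<le> b R)"
    using assms(2) ex_cut by blast
  then obtain pt :: "'a set \<Rightarrow> 'a \<Rightarrow> nat" where pt: "\<And>R. R \<in> \<A> \<Longrightarrow>
      (\<forall>x\<in>R. pt R x < a) \<and> (\<forall>i. card {x\<in>R. pt R x = i} \<le> b R)"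
    by metis
  define reg where "reg x = (THE R. R \<in> \<A> \<and> x \<in> R)" for x
  have reg: "reg x = R" if "R \<in> \<A>" "x \<in> R" for x R
    unfolding reg_def using that assms(1) by (intro the_equality) (auto simp: pairwise_def disjnt_def)
  have "{x\<in>R. pt (reg x) x = i} = {x\<in>R. pt R x = i}" if "R \<in> \<A>" for R i
    using reg[OF that] by auto
  then show ?thesis
    using pt reg by (intro exI[of _ "\<lambda>x. pt (reg x) x"]) auto
qed

section \<open>Legal queries that evaluate the tree rows\<close>

context sparse_query
begin

text \<open>A signed row is a difference of two counts, on \<open>Pos q\<close> and
  \<open>Neg q\<close>, which costs two sets per row. Sets larger than \<open>n\<close> are asked in
  pieces; the extra pieces are paid for by the total size over all rows, found by counting pairs of
  coin and row.\<close>

lemma reveals_tree: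
  assumes Z: "Z \<subseteq> {1..k}"
    and adm: "\<And>f. f \<in> F \<Longrightarrow> admissible_load (\<lambda>h u j. int (card {x\<in>f \<inter> Z. sl x = (h, u, j)}))"
    and load: "(\<Sum>x\<in>Z. 2 ^ (\<Lambda> - fst (sl x))) \<le> M * n"
  shows "reveals (2 * 2 ^ \<Lambda> + M) F
    {{x\<in>Z. sl x = (h, u, j)} | h u j. 1 \<le> h \<and> h \<le> \<Lambda> \<and> u < 2 ^ (\<Lambda> - h) \<and> j < 2 ^ (h - 1)}"
proof -
  define Pos where "Pos q = {x\<in>Z. tree_sign \<Lambda> 0 q (sl x) = 1}" for q
  define Neg where "Neg q = {x\<in>Z. tree_sign \<Lambda> 0 q (sl x) = - 1}" for q
  have finZ: "finite Z" using Z finite_subset by blast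
  have fin: "finite (Pos q)" "finite (Neg q)" for q
    using finZ by (simp_all add: Pos_def Neg_def)
  define N where "N q = (card (Pos q) div n + 1) + (card (Neg q) div n + 1)" for q
  have "reveals (N q) F ({Pos q} \<union> {Neg q})" for q
    unfolding N_def using Z by (intro reveals_Un reveals_single) (auto simp: Pos_def Neg_def)
  then have rev: "reveals (\<Sum>q<2 ^ \<Lambda>. N q) F (\<Union>q<2 ^ \<Lambda>. {Pos q} \<union> {Neg q})"
    by (intro reveals_UN) auto
  have "(\<Sum>q<2 ^ \<Lambda>. card (Pos q) div n + card (Neg q) div n) * n \<le> M * n"
  proof -
    have "(card (Pos q) div n + card (Neg q) div n) * n \<le> card {x\<in>Z. tree_sign \<Lambda> 0 q (sl x) \<noteq> 0}" for q
    proof -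
      have "(card (Pos q) div n + card (Neg q) div n) * n \<le> card (Pos q) + card (Neg q)"
        by (simp add: add_mult_distrib add_mono)
      also have "\<dots> = card (Pos q \<union> Neg q)"
        using fin by (intro card_Un_disjoint[symmetric]) (auto simp: Pos_def Neg_def)
      also have "\<dots> \<le> card {x\<in>Z. tree_sign \<Lambda> 0 q (sl x) \<noteq> 0}"
        using finZ by (intro card_mono) (auto simp: Pos_def Neg_def)
      finally show ?thesis .
    qed
    then have "(\<Sum>q<2 ^ \<Lambda>. card (Pos q) div n + card (Neg q) div n) * n \<le>
        (\<Sum>q<2 ^ \<Lambda>. card {x\<in>Z. tree_sign \<Lambda> 0 q (sl x) \<noteq> 0})"
      unfolding sum_distrib_right by (intro sum_mono) auto
    also have "\<dots> = (\<Sum>x\<in>Z. card {q\<in>{..<2 ^ \<Lambda>}. tree_sign \<Lambda> 0 q (sl x) \<noteq> 0})"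
      using finZ by (intro sum_card_swap) auto
    also have "\<dots> \<le> (\<Sum>x\<in>Z. 2 ^ (\<Lambda> - fst (sl x)))"
    proof (rule sum_mono)
      fix x
      show "card {q\<in>{..<2 ^ \<Lambda>}. tree_sign \<Lambda> 0 q (sl x) \<noteq> 0} \<le> 2 ^ (\<Lambda> - fst (sl x))"
        using card_tree_sign_support[of \<Lambda> 0 "fst (sl x)" "fst (snd (sl x))" "snd (snd (sl x))"] by simp
    qed
    finally show ?thesis using load by (rule order_trans)
  qed
  then have "(\<Sum>q<2 ^ \<Lambda>. card (Pos q) div n + card (Neg q) div n) \<le> M"
    using n_pos by simp
  then have le: "(\<Sum>q<2 ^ \<Lambda>. N q) \<le> 2 * 2 ^ \<Lambda> + M"
    using sum.distrib[of "\<lambda>_. 2" "\<lambda>q. card (Pos q) div n + card (Neg q) div n" "{..<2 ^ \<Lambda>}"]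
    by (simp add: N_def)
  have row: "tree_row \<Lambda> 0 (\<lambda>h u j. int (card {x\<in>f \<inter> Z. sl x = (h, u, j)})) q =
      int (card (f \<inter> Pos q)) - int (card (f \<inter> Neg q))" for f q
  proof -
    have "(\<Sum>x\<in>f \<inter> Z. tree_sign \<Lambda> 0 q (sl x)) =
        (\<Sum>x\<in>f \<inter> Z. (if tree_sign \<Lambda> 0 q (sl x) = 1 then 1 else 0) -
          (if tree_sign \<Lambda> 0 q (sl x) = - 1 then 1 else 0))"
    proof (rule sum.cong[OF refl])
      fix x
      show "tree_sign \<Lambda> 0 q (sl x) = (if tree_sign \<Lambda> 0 q (sl x) = 1 then 1 else 0) -
          (if tree_sign \<Lambda> 0 q (sl x) = - 1 then 1 else 0)"
        using tree_sign_cases[of \<Lambda> 0 q "sl x"] by auto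
    qed
    also have "\<dots> = int (card {x\<in>f \<inter> Z. tree_sign \<Lambda> 0 q (sl x) = 1}) -
        int (card {x\<in>f \<inter> Z. tree_sign \<Lambda> 0 q (sl x) = - 1})"
      using finZ by (simp add: sum_subtractf sum.inter_filter[symmetric])
    also have "{x\<in>f \<inter> Z. tree_sign \<Lambda> 0 q (sl x) = 1} = f \<inter> Pos q"
      by (auto simp: Pos_def)
    also have "{x\<in>f \<inter> Z. tree_sign \<Lambda> 0 q (sl x) = - 1} = f \<inter> Neg q"
      by (auto simp: Neg_def)
    finally show ?thesis using tree_row_eq_sum[of "f \<inter> Z" \<Lambda> 0 sl q] finZ by simp
  qed
  show ?thesis
  proof (rule reveals_trans[OF rev _ le])
    fix f g H
    assume fg: "f \<in> F" "g \<in> F"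
      and agree: "\<And>H. H \<in> (\<Union>q<2 ^ \<Lambda>. {Pos q} \<union> {Neg q}) \<Longrightarrow> card (f \<inter> H) = card (g \<inter> H)"
      and "H \<in> {{x\<in>Z. sl x = (h, u, j)} | h u j. 1 \<le> h \<and> h \<le> \<Lambda> \<and> u < 2 ^ (\<Lambda> - h) \<and> j < 2 ^ (h - 1)}"
    then obtain h u j where H: "H = {x\<in>Z. sl x = (h, u, j)}" "1 \<le> h" "h \<le> \<Lambda>" "u < 2 ^ (\<Lambda> - h)" "j < 2 ^ (h - 1)"
      by blast
    have "int (card {x\<in>f \<inter> Z. sl x = (h, u, j)}) = int (card {x\<in>g \<inter> Z. sl x = (h, u, j)})"
    proof (rule tree_row_injective[OF adm[OF fg(1)] adm[OF fg(2)] _ H(2,3) _ H(5), where v = 0])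
      fix q :: nat assume q: "q < 2 ^ \<Lambda>"
      have "Pos q \<in> (\<Union>q<2 ^ \<Lambda>. {Pos q} \<union> {Neg q})" "Neg q \<in> (\<Union>q<2 ^ \<Lambda>. {Pos q} \<union> {Neg q})"
        using q by auto
      then have "card (f \<inter> Pos q) = card (g \<inter> Pos q)" "card (f \<inter> Neg q) = card (g \<inter> Neg q)"
        by (simp_all only: agree)
      then show "tree_row \<Lambda> 0 (\<lambda>h u j. int (card {x\<in>f \<inter> Z. sl x = (h, u, j)})) q =
          tree_row \<Lambda> 0 (\<lambda>h u j. int (card {x\<in>g \<inter> Z. sl x = (h, u, j)})) q"
        unfolding row by simp
    qed (use H(4) in simp)
    moreover have "{x\<in>f \<inter> Z. sl x = (h, u, j)} = f \<inter> H" "{x\<in>g \<inter> Z. sl x = (h, u, j)} = g \<inter> H"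
      unfolding H(1) by auto
    ultimately show "card (f \<inter> H) = card (g \<inter> H)" by simp
  qed
qed

text \<open>A slot with room for \<open>s R\<close> coins costs at most \<open>s R\<close>
  consecutive slots, so the regions of one level fit into \<open>2 ^ (L - 1)\<close> slots. The tree
  has height \<open>Suc L\<close> because only odd nodes are used, and these make up half of each
  height below the root.\<close>

lemma reveals_light:
  fixes P :: "'i \<Rightarrow> nat set"
  assumes "finite A" "\<And>R. R \<in> A \<Longrightarrow> P R \<subseteq> {1..k}"
    and disj: "\<And>R R'. R \<in> A \<Longrightarrow> R' \<in> A \<Longrightarrow> R \<noteq> R' \<Longrightarrow> P R \<inter> P R' = {}"
    and lev: "\<And>R. R \<in> A \<Longrightarrow> 1 \<le> lev R \<and> lev R \<le> L"
    and size: "\<And>R. R \<in> A \<Longrightarrow> card (P R) \<le> 4 ^ (lev R - 1)"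
    and s: "\<And>R. R \<in> A \<Longrightarrow> 1 \<le> s R \<and> s R \<le> 2 ^ (lev R - 1)"
      "\<And>f R. f \<in> F \<Longrightarrow> R \<in> A \<Longrightarrow> card (f \<inter> P R) \<le> s R"
    and total: "\<And>h. (\<Sum>R | R \<in> A \<and> lev R = h. s R) \<le> 2 ^ (L - 1)"
    and L: "1 \<le> L" "4 ^ L \<le> n"
  shows "reveals (5 * 2 ^ L) F (P ` A)"
proof -
  let ?B = "\<lambda>h. {R. R \<in> A \<and> lev R = h}"
  have "\<forall>h. \<exists>J. inj_on J (?B h) \<and> (\<forall>R\<in>?B h. J R < sum s (?B h) \<and>
      (\<exists>e. 2 ^ e \<le> s R \<and> s R < 2 ^ Suc e \<and> 2 ^ e dvd Suc (J R)))"
    using assms(1) s(1) by (intro allI ex_dyadic_slots) auto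
  then obtain J where J: "\<And>h. inj_on (J h) (?B h)"
    "\<And>h R. R \<in> ?B h \<Longrightarrow> J h R < sum s (?B h)"
    "\<And>h R. R \<in> ?B h \<Longrightarrow> \<exists>e. 2 ^ e \<le> s R \<and> s R < 2 ^ Suc e \<and> 2 ^ e dvd Suc (J h R)"
    by (auto dest!: choice)
  \<comment> \<open>The slots of all odd nodes at height \<open>h\<close> are numbered
    consecutively, \<open>2 ^ (h - 1)\<close> per node: the quotient selects the node, the remainder
    the slot in it.\<close>
  define slot where "slot R = (let h = lev R; m = 2 ^ (h - 1) in (h, 2 * (J h R div m) + 1, J h R mod m))" for R
  have slot_inj: "R = R'" if "R \<in> A" "R' \<in> A" "slot R = slot R'" for R R'
  proof -
    have "lev R = lev R'" using that(3) by (simp add: slot_def Let_def)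
    moreover from this have "J (lev R) R = J (lev R) R'"
      using that(3) by (simp add: slot_def Let_def) (metis div_mult_mod_eq)
    ultimately show ?thesis using inj_onD[OF J(1)[of "lev R"]] that by simp
  qed
  define Z where "Z = (\<Union>R\<in>A. P R)"
  define own where "own x = (THE R. R \<in> A \<and> x \<in> P R)" for x
  have own: "own x = R" if "R \<in> A" "x \<in> P R" for x R
    unfolding own_def using that disj by (intro the_equality) blast+
  define sl where "sl x = slot (own x)" for x
  have fibre: "{x\<in>Z. sl x = slot R} = P R" if "R \<in> A" for R
  proof (rule equalityI; rule subsetI)
    fix x assume "x \<in> {x\<in>Z. sl x = slot R}"
    then obtain R' where R': "R' \<in> A" "x \<in> P R'" "slot (own x) = slot R"
      by (auto simp: Z_def sl_def)
    then have "R' = R" using own slot_inj that by metis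
    then show "x \<in> P R" using R' by simp
  next
    fix x assume "x \<in> P R"
    then show "x \<in> {x\<in>Z. sl x = slot R}" using own that by (auto simp: Z_def sl_def)
  qed
  have fits: "fits (snd (snd (slot R))) (int (card (f \<inter> P R)))" if R: "R \<in> A" and f: "f \<in> F" for R f
  proof -
    let ?h = "lev R"
    obtain e where e: "2 ^ e \<le> s R" "s R < 2 ^ Suc e" "2 ^ e dvd Suc (J ?h R)"
      using J(3)[of R ?h] R by blast
    \<comment> \<open>As \<open>2 ^ e\<close> divides the number of slots per node, the divisibility
      of \<open>Suc (J ?h R)\<close> survives the passage to the remainder.\<close>
    have "(2::nat) ^ e \<le> 2 ^ (?h - 1)" using e(1) s(1)[OF R] by linarith
    then have "e \<le> ?h - 1" by simp
    then have "(2::nat) ^ e dvd 2 ^ (?h - 1)" by (rule le_imp_power_dvd)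
    then have "(2::nat) ^ e dvd J ?h R div 2 ^ (?h - 1) * 2 ^ (?h - 1)" by (rule dvd_mult)
    moreover have "J ?h R div 2 ^ (?h - 1) * 2 ^ (?h - 1) + Suc (J ?h R mod 2 ^ (?h - 1)) = Suc (J ?h R)"
      by (simp only: add_Suc_right div_mult_mod_eq)
    ultimately have "2 ^ e dvd Suc (J ?h R mod 2 ^ (?h - 1))"
      using e(3) by (metis dvd_add_right_iff)
    moreover have "int (card (f \<inter> P R)) < 2 ^ Suc e"
    proof -
      have "card (f \<inter> P R) < 2 ^ Suc e" using s(2)[OF f R] e(2) by linarith
      then have "int (card (f \<inter> P R)) < int (2 ^ Suc e)" by (simp only: of_nat_less_iff)
      then show ?thesis by simp
    qed
    ultimately show ?thesis by (auto simp: fits_def slot_def Let_def intro!: exI[of _ e])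
  qed
  have adm: "admissible_load (\<lambda>h u j. int (card {x\<in>f \<inter> Z. sl x = (h, u, j)}))" if f: "f \<in> F" for f
    unfolding admissible_load_def
  proof (intro allI)
    fix h u j
    show "fits j (int (card {x\<in>f \<inter> Z. sl x = (h, u, j)})) \<and>
      (even u \<longrightarrow> int (card {x\<in>f \<inter> Z. sl x = (h, u, j)}) = 0)"
    proof (cases "\<exists>R\<in>A. slot R = (h, u, j)")
      case True
      then obtain R where R: "R \<in> A" "slot R = (h, u, j)" by blast
      then have "{x\<in>f \<inter> Z. sl x = (h, u, j)} = f \<inter> P R" using fibre[OF R(1)] by auto
      moreover have "odd u" using R(2) by (auto simp: slot_def Let_def)
      ultimately show ?thesis using fits[OF R(1) f] R(2) by simp
    next
      case False
      have "sl x \<noteq> (h, u, j)" if "x \<in> Z" for x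
        using that False own by (auto simp: Z_def sl_def)
      then have "{x\<in>f \<inter> Z. sl x = (h, u, j)} = {}" by auto
      then have "card {x\<in>f \<inter> Z. sl x = (h, u, j)} = 0" by (simp only: card.empty)
      then show ?thesis by (simp only: fits_def) (auto intro!: exI[of _ 0])
    qed
  qed
  have ZP: "Z \<subseteq> {1..k}" using assms(2) by (auto simp: Z_def)
  have finP: "finite (P R)" if "R \<in> A" for R using assms(2)[OF that] finite_subset by blast
  have load: "(\<Sum>x\<in>Z. 2 ^ (Suc L - fst (sl x))) \<le> 2 ^ L * n"
  proof -
    have "(\<Sum>x\<in>Z. 2 ^ (Suc L - fst (sl x))) = (\<Sum>R\<in>A. \<Sum>x\<in>P R. 2 ^ (Suc L - fst (sl x)))"
      unfolding Z_def using assms(1) finP disj by (intro sum.UNION_disjoint) auto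
    also have "\<dots> = (\<Sum>R\<in>A. card (P R) * 2 ^ (Suc L - lev R))"
    proof (rule sum.cong[OF refl])
      fix R assume R: "R \<in> A"
      have "fst (sl x) = lev R" if "x \<in> P R" for x
        using own[OF R that] by (simp add: sl_def slot_def Let_def)
      then show "(\<Sum>x\<in>P R. 2 ^ (Suc L - fst (sl x))) = card (P R) * 2 ^ (Suc L - lev R)" by simp
    qed
    also have "\<dots> \<le> (\<Sum>R\<in>A. 4 ^ (lev R - 1) * 2 ^ (Suc L - lev R))"
      using size by (intro sum_mono mult_right_mono) auto
    also have "\<dots> = (\<Sum>h\<in>{1..L}. \<Sum>R\<in>?B h. 4 ^ (lev R - 1) * 2 ^ (Suc L - lev R))"
      using assms(1) lev by (intro sum.group[symmetric]) auto
    \<comment> \<open>At most \<open>2 ^ (L - 1)\<close> regions of \<open>4 ^ (h - 1)\<close>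
      coins, each in \<open>2 ^ (Suc L - h)\<close> rows: the products form a geometric series in
      \<open>h\<close>, so no factor \<open>L\<close> is lost.\<close>
    also have "\<dots> \<le> (\<Sum>h\<in>{1..L}. 2 ^ (2 * L - 1) * 2 ^ (h - 1))"
    proof (rule sum_mono)
      fix h assume h: "h \<in> {1..L}"
      have "card (?B h) \<le> sum s (?B h)"
        using s(1) sum_mono[of "?B h" "\<lambda>_. 1" s] by auto
      then have card: "card (?B h) \<le> 2 ^ (L - 1)" using total[of h] by simp
      have "(\<Sum>R\<in>?B h. 4 ^ (lev R - 1) * 2 ^ (Suc L - lev R)) = card (?B h) * (4 ^ (h - 1) * 2 ^ (Suc L - h))"
        by simp
      also have "\<dots> \<le> 2 ^ (L - 1) * (4 ^ (h - 1) * 2 ^ (Suc L - h))"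
        using card by (rule mult_right_mono) simp
      also have "\<dots> = 2 ^ ((L - 1) + (2 * (h - 1) + (Suc L - h)))"
        by (simp add: power_add power_mult)
      also have "(L - 1) + (2 * (h - 1) + (Suc L - h)) = (2 * L - 1) + (h - 1)"
        using h by auto
      finally show "(\<Sum>R\<in>?B h. 4 ^ (lev R - 1) * 2 ^ (Suc L - lev R)) \<le> (2::nat) ^ (2 * L - 1) * 2 ^ (h - 1)"
        by (simp add: power_add)
    qed
    also have "\<dots> = 2 ^ (2 * L - 1) * (\<Sum>h<L. 2 ^ h)"
      unfolding sum_distrib_left
      by (rule sum.reindex_bij_witness[of _ Suc "\<lambda>h. h - 1"]) auto
    also have "(\<Sum>h<L. 2 ^ h) \<le> (2::nat) ^ L"
      using sum_power2[of L] by (simp add: atLeast0LessThan)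
    also have "2 ^ (2 * L - 1) * 2 ^ L \<le> (2::nat) ^ (2 * L) * 2 ^ L"
      by (intro mult_right_mono power_increasing) auto
    also have "\<dots> \<le> 2 ^ L * n"
      using L(2) by (simp add: power_mult)
    finally show ?thesis by simp
  qed
  have "reveals (2 * 2 ^ Suc L + 2 ^ L) F
    {{x\<in>Z. sl x = (h, u, j)} | h u j. 1 \<le> h \<and> h \<le> Suc L \<and> u < 2 ^ (Suc L - h) \<and> j < 2 ^ (h - 1)}"
    by (rule reveals_tree[OF ZP adm load])
  then have rev: "reveals (5 * 2 ^ L) F
    {{x\<in>Z. sl x = (h, u, j)} | h u j. 1 \<le> h \<and> h \<le> Suc L \<and> u < 2 ^ (Suc L - h) \<and> j < 2 ^ (h - 1)}"
    (is "reveals _ F ?H") by simp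
  have sub: "P R \<in> ?H" if R: "R \<in> A" for R
  proof -
    let ?h = "lev R"
    obtain h u j where slot: "slot R = (h, u, j)" by (cases "slot R") auto
    then have huj: "h = ?h" "u = 2 * (J ?h R div 2 ^ (?h - 1)) + 1" "j = J ?h R mod 2 ^ (?h - 1)"
      by (auto simp: slot_def Let_def)
    have h: "1 \<le> ?h" "?h \<le> L" using lev[OF R] by auto
    have "J ?h R < 2 ^ (L - 1)" using J(2)[of R ?h] R total[of ?h] by auto
    also have "L - 1 = (L - ?h) + (?h - 1)" using h by simp
    finally have "J ?h R div 2 ^ (?h - 1) < 2 ^ (L - ?h)"
      by (simp add: less_mult_imp_div_less power_add)
    then have "u < 2 ^ (Suc L - ?h)"
      unfolding huj(2) using h by (simp add: Suc_diff_le)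
    moreover have "j < 2 ^ (?h - 1)" unfolding huj(3) by simp
    ultimately show ?thesis
      using fibre[OF R] slot h unfolding huj(1) by fastforce
  qed
  show ?thesis
  proof (rule reveals_trans[OF rev _ order_refl])
    fix f g H
    assume agree: "\<And>H. H \<in> ?H \<Longrightarrow> card (f \<inter> H) = card (g \<inter> H)" and "H \<in> P ` A"
    then have "H \<in> ?H" using sub by blast
    then show "card (f \<inter> H) = card (g \<inter> H)" by (rule agree)
  qed
qed

end

section \<open>The pipeline\<close>

lemma label_class_eq:
  assumes "g \<subseteq> \<Union>\<P>" "\<And>R x. R \<in> \<P> \<Longrightarrow> x \<in> R \<Longrightarrow> \<phi> x = \<psi> R"
  shows "{x\<in>g. \<phi> x = \<beta>} = g \<inter> \<Union>{R\<in>\<P>. \<psi> R = \<beta>}"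
proof (rule equalityI; rule subsetI)
  fix x assume x: "x \<in> {x\<in>g. \<phi> x = \<beta>}"
  then obtain R where "R \<in> \<P>" "x \<in> R" using assms(1) by blast
  then show "x \<in> g \<inter> \<Union>{R\<in>\<P>. \<psi> R = \<beta>}" using assms(2)[of R x] x by auto
next
  fix x assume "x \<in> g \<inter> \<Union>{R\<in>\<P>. \<psi> R = \<beta>}"
  then obtain R where "x \<in> g" "R \<in> \<P>" "x \<in> R" "\<psi> R = \<beta>" by blast
  then show "x \<in> {x\<in>g. \<phi> x = \<beta>}" using assms(2)[of R x] by simp
qed

lemma four_power_halves: "1 \<le> L \<Longrightarrow> (4::nat) ^ L = 2 * (2 ^ L * 2 ^ (L - 1))"
  by (cases L) (simp_all flip: power_mult_distrib)

context sparse_query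
begin

text \<open>A region with more than \<open>2 ^ (lev R - 1)\<close> coins may be too heavy for a node
  of its height. By \<open>total\<close> there are at most \<open>2 ^ (L - h)\<close> such regions
  at level \<open>h\<close>, hence at most \<open>2 ^ L\<close> in all, and their parts are small
  enough to be asked directly.\<close>

lemma reveals_parts:
  assumes pos: "position \<P> f" and A: "A \<subseteq> \<P>"
    and P: "\<And>R. R \<in> A \<Longrightarrow> P R \<subseteq> R"
    and lev: "\<And>R. R \<in> A \<Longrightarrow> 1 \<le> lev R \<and> lev R \<le> L"
    and size: "\<And>R. R \<in> A \<Longrightarrow> card (P R) \<le> 4 ^ (lev R - 1)"
    and total: "\<And>h. (\<Sum>R | R \<in> A \<and> lev R = h. card (f \<inter> R)) \<le> 2 ^ (L - 1)"
    and L: "1 \<le> L" "4 ^ L \<le> n"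
  shows "reveals (6 * 2 ^ L) (consistent \<P> f) (P ` A)"
proof -
  let ?s = "\<lambda>R. card (f \<inter> R)"
  define Light where "Light = {R\<in>A. ?s R \<le> 2 ^ (lev R - 1)}"
  define Heavy where "Heavy = {R\<in>A. 2 ^ (lev R - 1) < ?s R}"
  have finA: "finite A" using A position_finite(1)[OF pos] finite_subset by blast
  have sub: "P R \<subseteq> {1..k}" if "R \<in> A" for R
    using P[OF that] that A pos by (auto simp: position_def)
  have "reveals (5 * 2 ^ L) (consistent \<P> f) (P ` Light)"
  proof (rule reveals_light[where s = ?s and lev = lev])
    show "finite Light" using finA by (simp add: Light_def)
    show "P R \<inter> P R' = {}" if "R \<in> Light" "R' \<in> Light" "R \<noteq> R'" for R R'
    proof -
      have "disjnt R R'"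
        using that A pos by (intro pairwiseD[of disjnt \<P>]) (auto simp: Light_def position_def)
      moreover have "P R \<subseteq> R" "P R' \<subseteq> R'" using P that by (auto simp: Light_def)
      ultimately show ?thesis unfolding disjnt_def by blast
    qed
    show "1 \<le> ?s R \<and> ?s R \<le> 2 ^ (lev R - 1)" if "R \<in> Light" for R
      using that position_pos[OF pos] A by (auto simp: Light_def)
    show "card (g \<inter> P R) \<le> ?s R" if "g \<in> consistent \<P> f" "R \<in> Light" for g R
    proof -
      have R: "R \<in> A" "R \<in> \<P>" using that(2) A by (auto simp: Light_def)
      have "card (g \<inter> P R) \<le> card (g \<inter> R)"
        using P[OF R(1)] position_finite(4)[OF pos R(2)] by (intro card_mono) auto
      then show ?thesis using that(1) R(2) by (auto simp: consistent_def)
    qed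
    show "(\<Sum>R | R \<in> Light \<and> lev R = h. ?s R) \<le> 2 ^ (L - 1)" for h
    proof -
      have "(\<Sum>R | R \<in> Light \<and> lev R = h. ?s R) \<le> (\<Sum>R | R \<in> A \<and> lev R = h. ?s R)"
        using finA by (intro sum_mono2) (auto simp: Light_def)
      then show ?thesis using total[of h] by linarith
    qed
  qed (use sub lev size L in \<open>auto simp: Light_def\<close>)
  moreover have "reveals (2 ^ L) (consistent \<P> f) (P ` Heavy)"
  proof -
    have finH: "finite Heavy" using finA by (simp add: Heavy_def)
    have "card (P R) \<le> n" if "R \<in> Heavy" for R
    proof -
      have R: "R \<in> A" using that by (simp add: Heavy_def)
      have "(4::nat) ^ (lev R - 1) \<le> 4 ^ L"
        using lev[OF R] by (intro power_increasing) auto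
      then show ?thesis using size[OF R] L(2) by linarith
    qed
    then have rev: "reveals (card (P ` Heavy)) (consistent \<P> f) (P ` Heavy)"
      using finH sub by (intro reveals_direct) (auto simp: Heavy_def)
    have level: "card {R\<in>Heavy. lev R = h} \<le> 2 ^ (L - h)" if h: "h \<in> {1..L}" for h
    proof -
      have "card {R\<in>Heavy. lev R = h} * 2 ^ (h - 1) = (\<Sum>R | R \<in> Heavy \<and> lev R = h. 2 ^ (h - 1))"
        by simp
      also have "\<dots> \<le> (\<Sum>R | R \<in> Heavy \<and> lev R = h. ?s R)"
        by (intro sum_mono) (auto simp: Heavy_def)
      also have "\<dots> \<le> (\<Sum>R | R \<in> A \<and> lev R = h. ?s R)"
        using finA by (intro sum_mono2) (auto simp: Heavy_def)
      also have "\<dots> \<le> 2 ^ (L - 1)" by (rule total)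
      also have "L - 1 = (L - h) + (h - 1)" using h by simp
      finally show ?thesis by (simp add: power_add)
    qed
    have "card (P ` Heavy) \<le> card Heavy" using finH by (rule card_image_le)
    also have "\<dots> = (\<Sum>R\<in>Heavy. 1)" by simp
    also have "\<dots> = (\<Sum>h\<in>{1..L}. \<Sum>R | R \<in> Heavy \<and> lev R = h. 1)"
      using finH lev by (intro sum.group[symmetric]) (auto simp: Heavy_def)
    also have "\<dots> \<le> (\<Sum>h\<in>{1..L}. 2 ^ (L - h))"
      using level by (intro sum_mono) simp
    also have "\<dots> = (\<Sum>h<L. 2 ^ h)"
      by (rule sum.reindex_bij_witness[of _ "\<lambda>h. L - h" "\<lambda>h. L - h"]) auto
    also have "\<dots> \<le> 2 ^ L"
      using sum_power2[of L] by (simp add: atLeast0LessThan)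
    finally have "card (P ` Heavy) \<le> 2 ^ L" .
    then show ?thesis by (rule reveals_mono[OF rev])
  qed
  ultimately have "reveals (5 * 2 ^ L + 2 ^ L) (consistent \<P> f) (P ` Light \<union> P ` Heavy)"
    by (rule reveals_Un)
  moreover have "Light \<union> Heavy = A"
    by (auto simp: Light_def Heavy_def)
  then have "P ` Light \<union> P ` Heavy = P ` A"
    by (metis image_Un)
  ultimately show ?thesis by simp
qed

text \<open>The batch with label \<open>\<beta>\<close> enters the pipeline at time \<open>\<beta>\<close>; every batch in the pipeline sits
  at a different level, and each round cuts all its regions into four.\<close>

definition pipeline :: "nat \<Rightarrow> (nat \<Rightarrow> nat) \<Rightarrow> nat \<Rightarrow> nat set set \<Rightarrow> nat set \<Rightarrow> bool" where
  "pipeline L lab r \<P> f \<longleftrightarrow> position \<P> f \<and>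
     (\<forall>R\<in>\<P>. \<forall>x\<in>R. \<forall>y\<in>R. lab x = lab y) \<and>
     (\<forall>\<beta>. card {x\<in>f. lab x = \<beta>} \<le> 2 ^ (L - 1)) \<and>
     (\<forall>R\<in>\<P>. \<forall>x\<in>R. card R \<le> 4 ^ (L - (r - lab x)))"

text \<open>The constant is four parts per region times the \<open>6 * 2 ^ L\<close> queries of
  \<open>reveals_parts\<close>, one call of which serves all levels.\<close>

lemma pipeline_step:
  assumes pipe: "pipeline L lab r \<P> f" and L: "1 \<le> L" "4 ^ L \<le> n"
    and next_round: "\<And>\<P>' h. pipeline L lab (Suc r) \<P>' h \<Longrightarrow> \<Union>\<P>' \<subseteq> \<Union>\<P> \<Longrightarrow> solvable t (consistent \<P>' h)"
  shows "solvable (24 * 2 ^ L + t) (consistent \<P> f)"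
proof -
  have pos: "position \<P> f" and lab: "\<And>R x y. R \<in> \<P> \<Longrightarrow> x \<in> R \<Longrightarrow> y \<in> R \<Longrightarrow> lab x = lab y"
    and batch: "\<And>\<beta>. card {x\<in>f. lab x = \<beta>} \<le> 2 ^ (L - 1)"
    and size: "\<And>R x. R \<in> \<P> \<Longrightarrow> x \<in> R \<Longrightarrow> card R \<le> 4 ^ (L - (r - lab x))"
    using pipe unfolding pipeline_def by blast+
  define rl where "rl R = lab (SOME x. x \<in> R)" for R
  have rl: "rl R = lab x" if "R \<in> \<P>" "x \<in> R" for R x
    unfolding rl_def using that by (intro lab[OF that(1)] someI[of "\<lambda>x. x \<in> R"])
  define A where "A = {R\<in>\<P>. rl R \<le> r \<and> r - rl R < L}"
  define lev where "lev R = L - (r - rl R)" for R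
  have A: "A \<subseteq> \<P>" by (auto simp: A_def)
  have nonempty: "\<exists>x. x \<in> R" if "R \<in> \<P>" for R
    using that pos by (auto simp: position_def)
  have lev: "1 \<le> lev R \<and> lev R \<le> L" if "R \<in> A" for R
    using that by (auto simp: A_def lev_def)
  have sizeA: "card R \<le> 4 * 4 ^ (lev R - 1)" if "R \<in> A" for R
  proof -
    obtain x where x: "x \<in> R" using nonempty A \<open>R \<in> A\<close> by blast
    have "card R \<le> 4 ^ lev R" using size[of R x] rl[of R x] x A that by (auto simp: lev_def)
    also have "lev R = Suc (lev R - 1)" using lev[OF that] by simp
    finally show ?thesis by simp
  qed
  have dis: "pairwise disjnt \<P>" using pos by (simp add: position_def)
  have "\<exists>pt :: nat \<Rightarrow> nat. \<forall>R\<in>A. (\<forall>x\<in>R. pt x < 4) \<and> (\<forall>i. card {x\<in>R. pt x = i} \<le> 4 ^ (lev R - 1))"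
    using pairwise_subset[OF dis A] position_finite(4)[OF pos] A sizeA by (intro ex_common_cut) blast+
  then obtain pt :: "nat \<Rightarrow> nat" where pt: "\<And>R x. R \<in> A \<Longrightarrow> x \<in> R \<Longrightarrow> pt x < 4"
    "\<And>R i. R \<in> A \<Longrightarrow> card {x\<in>R. pt x = i} \<le> 4 ^ (lev R - 1)"
    by blast
  \<comment> \<open>Within \<open>A\<close> the level determines the label as
    \<open>r - (L - h)\<close>, so all regions of a level belong to a single batch.\<close>
  have batch_sum: "(\<Sum>R | R \<in> A \<and> lev R = h. card (f \<inter> R)) \<le> 2 ^ (L - 1)" for h
  proof (cases "h \<in> {1..L}")
    case False
    then have "{R. R \<in> A \<and> lev R = h} = {}" using lev by auto
    then show ?thesis by (simp only: sum.empty)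
  next
    case True
    have "(\<Sum>R | R \<in> A \<and> lev R = h. card (f \<inter> R)) = card (f \<inter> \<Union>{R. R \<in> A \<and> lev R = h})"
      using A by (intro position_sum(1)[OF pos]) auto
    also have "\<dots> \<le> card {x\<in>f. lab x = r - (L - h)}"
    proof (rule card_mono)
      show "finite {x\<in>f. lab x = r - (L - h)}" using position_finite(3)[OF pos] by simp
      show "f \<inter> \<Union>{R. R \<in> A \<and> lev R = h} \<subseteq> {x\<in>f. lab x = r - (L - h)}"
      proof
        fix x assume "x \<in> f \<inter> \<Union>{R. R \<in> A \<and> lev R = h}"
        then obtain R where R: "x \<in> f" "x \<in> R" "R \<in> A" "lev R = h" by blast
        then have "rl R = lab x" using rl A by blast
        then show "x \<in> {x\<in>f. lab x = r - (L - h)}" using R by (auto simp: A_def lev_def)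
      qed
    qed
    also have "\<dots> \<le> 2 ^ (L - 1)" by (rule batch)
    finally show ?thesis .
  qed
  have "reveals (card {..<4::nat} * (6 * 2 ^ L)) (consistent \<P> f) (\<Union>i<4. (\<lambda>R. {x\<in>R. pt x = i}) ` A)"
    using pt(2) lev batch_sum L by (intro reveals_UN_bound reveals_parts[OF pos A, where lev = lev]) auto
  moreover have "(\<Union>i<4. (\<lambda>R. {x\<in>R. pt x = i}) ` A) = {{x\<in>R. pt x = i} | R i. R \<in> A \<and> i < 4}"
    by auto
  ultimately have rev: "reveals (24 * 2 ^ L) (consistent \<P> f) {{x\<in>R. pt x = i} | R i. R \<in> A \<and> i < 4}"
    by simp
  show ?thesis
  proof (rule solvable_refine[OF pos A _ rev])
    show "pt x < 4" if "x \<in> \<Union>A" for x using that pt(1) by blast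
    fix \<P>' h
    assume pos': "position \<P>' h" and h: "h \<in> consistent \<P> f"
      and new: "\<And>P. P \<in> \<P>' \<Longrightarrow> P \<in> \<P> - A \<or> (\<exists>R\<in>A. \<exists>i<4. P = {x\<in>R. pt x = i})"
    have sub: "\<exists>R\<in>\<P>. P \<subseteq> R" if "P \<in> \<P>'" for P
      using new[OF that] A by auto
    show "solvable t (consistent \<P>' h)"
    proof (rule next_round)
      show "\<Union>\<P>' \<subseteq> \<Union>\<P>" using sub by blast
      show "pipeline L lab (Suc r) \<P>' h"
        unfolding pipeline_def
      proof (intro conjI allI ballI)
        show "lab x = lab y" if "P \<in> \<P>'" "x \<in> P" "y \<in> P" for P x y
          using sub[OF that(1)] that lab by blast
        show "card {x\<in>h. lab x = \<beta>} \<le> 2 ^ (L - 1)" for \<beta>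
        proof -
          \<comment> \<open>Labels are constant on regions, so the known counts fix the number of
            coins in a batch; it is the same for \<open>h\<close> and \<open>f\<close>.\<close>
          have "{x\<in>g. lab x = \<beta>} = g \<inter> \<Union>{R\<in>\<P>. rl R = \<beta>}" if "g \<subseteq> \<Union>\<P>" for g
            using that rl by (intro label_class_eq) auto
          moreover have "h \<subseteq> \<Union>\<P>" "f \<subseteq> \<Union>\<P>" using h pos by (auto simp: consistent_def position_def)
          ultimately show ?thesis
            using position_consistent(2)[OF pos h, of "{R\<in>\<P>. rl R = \<beta>}"] batch[of \<beta>] by auto
        qed
        show "card P \<le> 4 ^ (L - (Suc r - lab x))" if P: "P \<in> \<P>'" "x \<in> P" for P x
          using new[OF P(1)]
        proof
          assume "P \<in> \<P> - A"
          then have "\<not> (lab x \<le> r \<and> r - lab x < L)" "P \<in> \<P>" using rl P(2) by (auto simp: A_def)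
          \<comment> \<open>Truncated subtraction: before a batch enters, the exponent stays
            \<open>L\<close>; after it has left, it stays 0.\<close>
          then have "L - (Suc r - lab x) = L - (r - lab x)" by auto
          then show ?thesis using size[OF \<open>P \<in> \<P>\<close> P(2)] by simp
        next
          assume "\<exists>R\<in>A. \<exists>i<4. P = {x\<in>R. pt x = i}"
          then obtain R i where R: "R \<in> A" "P = {x\<in>R. pt x = i}" by blast
          then have "rl R = lab x" using rl A P(2) by blast
          then have "lev R - 1 = L - (Suc r - lab x)" using R(1) by (auto simp: lev_def A_def)
          then show ?thesis using pt(2)[OF R(1), of i] R(2) by simp
        qed
      qed (rule pos')
    qed
  qed
qed

text \<open>\<open>m\<close> rounds let every batch in and \<open>L\<close> more let the last one
  out; by then no region has more than one element.\<close>

lemma solvable_pipeline: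
  assumes "pipeline L lab r \<P> f" "1 \<le> L" "4 ^ L \<le> n" "\<And>x. x \<in> \<Union>\<P> \<Longrightarrow> lab x < m"
    "r + t = m + L"
  shows "solvable (t * (24 * 2 ^ L)) (consistent \<P> f)"
  using assms(1,4,5)
proof (induction t arbitrary: r \<P> f)
  case 0
  have "card R \<le> 1" if R: "R \<in> \<P>" for R
  proof (cases "R = {}")
    case False
    then obtain x where x: "x \<in> R" by blast
    then have "lab x < m" using 0(2) R by blast
    then have "L - (r - lab x) = 0" using 0(3) by simp
    moreover have "card R \<le> 4 ^ (L - (r - lab x))" using 0(1) R x unfolding pipeline_def by blast
    ultimately show ?thesis by simp
  qed simp
  moreover have "position \<P> f" using 0(1) unfolding pipeline_def by blast
  ultimately show ?case using solvable_singletons by (simp del: solvable.simps)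
next
  case (Suc t)
  have "solvable (24 * 2 ^ L + t * (24 * 2 ^ L)) (consistent \<P> f)"
  proof (rule pipeline_step[OF Suc.prems(1) assms(2,3)])
    fix \<P>' h assume "pipeline L lab (Suc r) \<P>' h" "\<Union>\<P>' \<subseteq> \<Union>\<P>"
    then show "solvable (t * (24 * 2 ^ L)) (consistent \<P>' h)"
      using Suc.prems(2,3) by (intro Suc.IH[of "Suc r"]) auto
  qed
  then show ?case by simp
qed

text \<open>Regions are packed by their numbers of coins, and the label is the position divided by
  the capacity \<open>2 ^ (L - 1)\<close>. No interval crosses a multiple of the capacity, so no
  batch is overfull.\<close>

lemma solvable_batches:
  assumes pos: "position \<P> f" and L: "1 \<le> L" "4 ^ L \<le> n" "n < 4 ^ Suc L"
    and size: "\<And>R. R \<in> \<P> \<Longrightarrow> card R \<le> 4 ^ L"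
    and count: "\<And>R. R \<in> \<P> \<Longrightarrow> card (f \<inter> R) \<le> 2 ^ (L - 1)"
  shows "solvable (432 * 4 ^ L) (consistent \<P> f)"
proof -
  let ?s = "\<lambda>R. card (f \<inter> R)" and ?D = "2 ^ (L - 1) :: nat"
  have fin: "finite \<P>" and dis: "pairwise disjnt \<P>" using pos by (auto simp: position_def)
  obtain p where p: "\<And>R. R \<in> \<P> \<Longrightarrow> p R + ?s R \<le> 2 * sum ?s \<P>"
    "\<And>R. R \<in> \<P> \<Longrightarrow> p R mod ?D + ?s R \<le> ?D"
    "\<And>R R'. R \<in> \<P> \<Longrightarrow> R' \<in> \<P> \<Longrightarrow> R \<noteq> R' \<Longrightarrow> p R + ?s R \<le> p R' \<or> p R' + ?s R' \<le> p R"
  proof -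
    have "\<exists>p. (\<forall>R\<in>\<P>. p R + ?s R \<le> 2 * sum ?s \<P> \<and> p R mod ?D + ?s R \<le> ?D) \<and>
        (\<forall>R\<in>\<P>. \<forall>R'\<in>\<P>. R \<noteq> R' \<longrightarrow> p R + ?s R \<le> p R' \<or> p R' + ?s R' \<le> p R)"
      using count by (intro ex_packing[OF fin]) simp_all
    then obtain p where "\<forall>R\<in>\<P>. p R + ?s R \<le> 2 * sum ?s \<P> \<and> p R mod ?D + ?s R \<le> ?D"
      "\<forall>R\<in>\<P>. \<forall>R'\<in>\<P>. R \<noteq> R' \<longrightarrow> p R + ?s R \<le> p R' \<or> p R' + ?s R' \<le> p R"
      by (elim exE conjE)
    then show ?thesis by (intro that[of p]) blast+
  qed
  define reg where "reg x = (THE R. R \<in> \<P> \<and> x \<in> R)" for x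
  have reg: "reg x = R" if "R \<in> \<P>" "x \<in> R" for x R
    unfolding reg_def using that dis by (intro the_equality) (auto simp: pairwise_def disjnt_def)
  define lab where "lab x = p (reg x) div ?D" for x
  have lab: "lab x = p R div ?D" if "R \<in> \<P>" "x \<in> R" for x R
    using reg[OF that] by (simp add: lab_def)
  have fP: "f \<subseteq> \<Union>\<P>" using pos by (simp add: position_def)
  have pipe: "pipeline L lab 0 \<P> f"
    unfolding pipeline_def
  proof (intro conjI allI ballI)
    show "card {x\<in>f. lab x = \<beta>} \<le> 2 ^ (L - 1)" for \<beta>
    proof -
      let ?B = "{R\<in>\<P>. p R div ?D = \<beta>}"
      have "{x\<in>f. lab x = \<beta>} = f \<inter> \<Union>?B"
        using fP lab by (intro label_class_eq) auto
      then have "card {x\<in>f. lab x = \<beta>} = sum ?s ?B"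
        using position_sum(1)[OF pos, of ?B] by auto
      also have "\<dots> \<le> ?D"
      proof (rule sum_intervals_le[where pos = p and a = "\<beta> * ?D"])
        fix R assume R: "R \<in> ?B"
        then have "p R = \<beta> * ?D + p R mod ?D" using div_mult_mod_eq[of "p R" ?D] by auto
        then show "\<beta> * ?D \<le> p R \<and> p R + ?s R \<le> \<beta> * ?D + ?D"
          using p(2)[of R] R by auto
      qed (use fin p(3) in auto)
      finally show ?thesis .
    qed
    show "card R \<le> 4 ^ (L - (0 - lab x))" if "R \<in> \<P>" "x \<in> R" for R x
      using size[OF that(1)] by simp
  qed (use pos lab in auto)
  define m where "m = 2 * n div ?D + 1"
  have "lab x < m" if "x \<in> \<Union>\<P>" for x
  proof -
    obtain R where R: "R \<in> \<P>" "x \<in> R" using \<open>x \<in> \<Union>\<P>\<close> by blast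
    have "p R \<le> 2 * n" using p(1)[OF R(1)] position_sum(2)[OF pos, of \<P>] by simp
    then have "p R div ?D \<le> 2 * n div ?D" by (rule div_le_mono)
    then show ?thesis using lab[OF R] by (simp add: m_def)
  qed
  then have sol: "solvable ((m + L) * (24 * 2 ^ L)) (consistent \<P> f)"
    by (intro solvable_pipeline[OF pipe L(1,2)]) auto
  \<comment> \<open>At most \<open>16 * 2 ^ L\<close> labels by \<open>n < 4 ^ Suc L\<close>, and
    \<open>L < 2 ^ L\<close>. The final constant is \<open>18 * 24 = 432\<close>.\<close>
  have "m + L \<le> 18 * 2 ^ L"
  proof -
    have "2 * n < 16 * 2 ^ L * ?D" using L(3) four_power_halves[OF L(1)] by simp
    then have "2 * n div ?D < 16 * 2 ^ L" by (rule less_mult_imp_div_less)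
    moreover have "L < 2 ^ L" by (rule less_exp)
    ultimately show ?thesis unfolding m_def by linarith
  qed
  then have "(m + L) * (24 * 2 ^ L) \<le> 18 * 2 ^ L * (24 * 2 ^ L)"
    by (rule mult_right_mono) simp
  also have "\<dots> = 432 * 4 ^ L"
    by (simp flip: power_mult_distrib)
  finally show ?thesis using sol by (rule solvable_mono[rotated])
qed

text \<open>Regions with more than \<open>2 ^ (L - 1)\<close> coins exceed the capacity of a batch,
  but there are at most \<open>8 * 2 ^ L\<close> of them. Each is cut into \<open>2 * 2 ^ L\<close>
  pieces, too small to be overfull, and all pieces are asked directly.\<close>

lemma solvable_dense_regions:
  assumes pos: "position \<P> f" and L: "1 \<le> L" "4 ^ L \<le> n" "n < 4 ^ Suc L"
    and size: "\<And>R. R \<in> \<P> \<Longrightarrow> card R \<le> 4 ^ L"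
  shows "solvable (16 * 4 ^ L + 432 * 4 ^ L) (consistent \<P> f)"
proof -
  let ?D = "2 ^ (L - 1) :: nat"
  define A where "A = {R\<in>\<P>. ?D < card (f \<inter> R)}"
  have A: "A \<subseteq> \<P>" by (auto simp: A_def)
  have fin: "finite \<P>" "finite A" and dis: "pairwise disjnt \<P>"
    using pos by (auto simp: position_def A_def)
  have two: "2 * ?D = 2 ^ L" using L(1) by (cases L) auto
  have four: "(4::nat) ^ L = 2 ^ L * 2 ^ L" by (simp flip: power_mult_distrib)
  have "\<exists>pt :: nat \<Rightarrow> nat. \<forall>R\<in>A. (\<forall>x\<in>R. pt x < 2 * 2 ^ L) \<and> (\<forall>i. card {x\<in>R. pt x = i} \<le> ?D)"
  proof (rule ex_common_cut)
    show "pairwise disjnt A" using dis A by (rule pairwise_subset)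
    have "2 * 2 ^ L * ?D = 2 ^ L * (2 * ?D)" by simp
    then have "2 * 2 ^ L * ?D = 4 ^ L" by (simp only: two four)
    then show "finite R \<and> card R \<le> 2 * 2 ^ L * ?D" if "R \<in> A" for R
      using size[of R] that A position_finite(4)[OF pos] by auto
  qed
  then obtain pt :: "nat \<Rightarrow> nat" where pt: "\<And>R x. R \<in> A \<Longrightarrow> x \<in> R \<Longrightarrow> pt x < 2 * 2 ^ L"
    "\<And>R i. R \<in> A \<Longrightarrow> card {x\<in>R. pt x = i} \<le> ?D"
    by blast
  let ?C = "{{x\<in>R. pt x = i} | R i. R \<in> A \<and> i < 2 * 2 ^ L}"
  have C: "?C = (\<lambda>(R, i). {x\<in>R. pt x = i}) ` (A \<times> {..<2 * 2 ^ L})" by auto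
  have D_le: "?D \<le> 4 ^ L"
  proof -
    have "?D \<le> 2 ^ (2 * L)" by (intro power_increasing) auto
    then show ?thesis by (simp add: power_mult)
  qed
  have rev: "reveals (16 * 4 ^ L) (consistent \<P> f) ?C"
  proof (rule reveals_mono)
    show "reveals (card ?C) (consistent \<P> f) ?C"
    proof (rule reveals_direct)
      show "finite ?C" unfolding C using fin by simp
      show "H \<subseteq> {1..k} \<and> card H \<le> n" if "H \<in> ?C" for H
      proof -
        obtain R i where R: "R \<in> A" "H = {x\<in>R. pt x = i}" using \<open>H \<in> ?C\<close> by blast
        then have "H \<subseteq> {1..k}" using A pos by (auto simp: position_def)
        moreover have "card H \<le> n" using pt(2)[OF R(1), of i] R(2) D_le L(2) by simp
        ultimately show ?thesis by simp
      qed
    qed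
    have "card A * ?D \<le> (\<Sum>R\<in>A. card (f \<inter> R))"
      using sum_mono[of A "\<lambda>_. ?D" "\<lambda>R. card (f \<inter> R)"] by (simp add: A_def)
    also have "\<dots> \<le> n" by (rule position_sum(2)[OF pos A])
    also have "n \<le> 8 * 2 ^ L * ?D" using L(3) four_power_halves[OF L(1)] by simp
    finally have "card A \<le> 8 * 2 ^ L" by simp
    then have "card A * (2 * 2 ^ L) \<le> 8 * 2 ^ L * (2 * 2 ^ L)" by (rule mult_right_mono) simp
    moreover have "card ?C \<le> card A * (2 * 2 ^ L)"
      unfolding C using fin card_image_le[of "A \<times> {..<2 * 2 ^ L :: nat}"]
      by (simp add: card_cartesian_product)
    ultimately have "card ?C \<le> 8 * 2 ^ L * (2 * 2 ^ L)" by (rule order_trans[rotated])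
    then show "card ?C \<le> 16 * 4 ^ L" using four by simp
  qed
  show ?thesis
  proof (rule solvable_refine[OF pos A _ rev])
    show "pt x < 2 * 2 ^ L" if "x \<in> \<Union>A" for x using that pt(1) by blast
    fix \<P>' h
    assume pos': "position \<P>' h" and h: "h \<in> consistent \<P> f"
      and new: "\<And>P. P \<in> \<P>' \<Longrightarrow> P \<in> \<P> - A \<or> (\<exists>R\<in>A. \<exists>i<2 * 2 ^ L. P = {x\<in>R. pt x = i})"
    have "card P \<le> 4 ^ L \<and> card (h \<inter> P) \<le> ?D" if P: "P \<in> \<P>'" for P
      using new[OF P]
    proof
      assume "P \<in> \<P> - A"
      then show ?thesis using size h by (auto simp: A_def consistent_def)
    next
      assume "\<exists>R\<in>A. \<exists>i<2 * 2 ^ L. P = {x\<in>R. pt x = i}"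
      then obtain R i where R: "R \<in> A" "P = {x\<in>R. pt x = i}" by blast
      have "card (h \<inter> P) \<le> card P" using position_finite(4)[OF pos' P] by (intro card_mono) auto
      then show ?thesis using pt(2)[OF R(1), of i] R(2) D_le by simp
    qed
    then show "solvable (432 * 4 ^ L) (consistent \<P>' h)"
      by (intro solvable_batches[OF pos' L]) auto
  qed
qed

text \<open>\<open>k div 4 ^ L + 1\<close> pays for asking the initial regions one by one; the cost
  of everything afterwards does not depend on \<open>k\<close>.\<close>

lemma min_queries_dense:
  assumes L: "1 \<le> L" "4 ^ L \<le> n" "n < 4 ^ Suc L"
  shows "min_queries n k \<le> k div 4 ^ L + 1 + 448 * 4 ^ L"
proof -
  let ?a = "k div 4 ^ L + 1"
  have "k \<le> ?a * 4 ^ L"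
  proof -
    have "k div 4 ^ L * 4 ^ L + k mod 4 ^ L = k" "k mod 4 ^ L < 4 ^ L"
      by (rule div_mult_mod_eq) simp
    then show ?thesis unfolding add_mult_distrib mult_1 by linarith
  qed
  then obtain pt :: "nat \<Rightarrow> nat" where pt: "\<forall>x\<in>{1..k}. pt x < ?a" "\<forall>i. card {x\<in>{1..k}. pt x = i} \<le> 4 ^ L"
    using ex_cut[of "{1..k}" ?a "4 ^ L"] by auto
  let ?H = "(\<lambda>i. {x\<in>{1..k}. pt x = i}) ` {..<?a}"
  have rev: "reveals (card ?H) (sparse_sets n k) ?H"
    using pt(2) L(2) by (intro reveals_direct) (auto intro: order_trans)
  have "card ?H \<le> ?a"
    using card_image_le[of "{..<?a}" "\<lambda>i. {x\<in>{1..k}. pt x = i}"] by simp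
  with rev have "reveals ?a (sparse_sets n k) ?H"
    by (rule reveals_mono)
  then have "solvable (?a + (16 * 4 ^ L + 432 * 4 ^ L)) (sparse_sets n k)"
  proof (rule solvable_partition)
    show "f \<subseteq> \<Union>?H \<and> card f \<le> n" if "f \<in> sparse_sets n k" for f
      using that pt(1) by (auto simp: sparse_sets_def)
    show "solvable (16 * 4 ^ L + 432 * 4 ^ L) (consistent \<P> f)"
      if "position \<P> f" "\<P> \<subseteq> ?H" for \<P> f
      using that(2) pt(2) by (intro solvable_dense_regions[OF that(1) L]) auto
  qed (auto simp: pairwise_def disjnt_def)
  then have "min_queries n k \<le> ?a + (16 * 4 ^ L + 432 * 4 ^ L)" by (rule min_queries_le)
  then show ?thesis by simp
qed

end

section \<open>Synchronous halving\<close>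

context sparse_query
begin

text \<open>A position \<open>p i\<close> encodes a block, an index set and, as
  \<open>p i mod D\<close>, a weight exponent. A block offers \<open>D * 4 ^ D\<close> bits and is
  read by \<open>2 * 4 ^ D\<close> queries, one per subset of \<open>?U\<close>: about
  \<open>D / 2\<close> bits per query.\<close>

lemma reveals_weighing_block:
  fixes H :: "'i \<Rightarrow> nat set"
  assumes "finite I" and H: "\<And>i. i \<in> I \<Longrightarrow> H i \<subseteq> {1..k} \<and> card (H i) \<le> z"
    and disj: "\<And>i j. i \<in> I \<Longrightarrow> j \<in> I \<Longrightarrow> i \<noteq> j \<Longrightarrow> H i \<inter> H j = {}"
    and b: "\<And>i. i \<in> I \<Longrightarrow> 1 \<le> b i" "\<And>i f. i \<in> I \<Longrightarrow> f \<in> F \<Longrightarrow> card (f \<inter> H i) < 2 ^ b i"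
    and p: "\<And>i. i \<in> I \<Longrightarrow> p i mod D + b i \<le> D"
      "\<And>i j. i \<in> I \<Longrightarrow> j \<in> I \<Longrightarrow> i \<noteq> j \<Longrightarrow> p i + b i \<le> p j \<or> p j + b j \<le> p i"
      "\<And>i. i \<in> I \<Longrightarrow> p i div D div 4 ^ D = B"
    and D: "0 < D" "4 ^ D * D * z \<le> n"
  shows "reveals (2 * 4 ^ D) F (H ` I)"
proof -
  let ?U = "{..<2 * D + 1}"
  let ?\<A> = "{T. T \<subseteq> ?U \<and> D + 1 \<le> card T}"
  obtain e where e: "e ` {..<4 ^ D} \<subseteq> ?\<A>" "inj_on e {..<4 ^ D :: nat}"
    using card_le_inj[of "{..<4 ^ D :: nat}" ?\<A>] card_large_subsets[of D] by auto
  define T where "T i = e (p i div D mod 4 ^ D)" for i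
  have T: "T i \<subseteq> ?U" "D + 1 \<le> card (T i)" for i
    using e(1) by (auto simp: T_def image_subset_iff)
  have "\<exists>G. G \<subseteq> Pow (T i) \<and> (\<forall>q\<in>G. even (card q)) \<and> card G = 2 ^ (p i mod D)" for i
  proof (rule ex_even_subsets)
    show "finite (T i)" using T(1) finite_subset by blast
    have "p i mod D < D" using D(1) by simp
    then show "p i mod D < card (T i)" using T(2)[of i] by simp
  qed
  then obtain G where G: "\<And>i. G i \<subseteq> Pow (T i)" "\<And>i q. q \<in> G i \<Longrightarrow> even (card q)"
    "\<And>i. card (G i) = 2 ^ (p i mod D)"
    by metis
  define X where "X q = (\<Union>i\<in>{i\<in>I. q \<inter> T i \<in> G i}. H i)" for q
  have finH: "finite (H i)" if "i \<in> I" for i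
    using H[OF that] finite_subset by blast
  have card_X: "card (f \<inter> X q) = (\<Sum>i | i \<in> I \<and> q \<inter> T i \<in> G i. card (f \<inter> H i))" for f q
  proof -
    have "f \<inter> X q = (\<Union>i\<in>{i\<in>I. q \<inter> T i \<in> G i}. f \<inter> H i)" by (auto simp: X_def)
    also have "card \<dots> = (\<Sum>i | i \<in> I \<and> q \<inter> T i \<in> G i. card (f \<inter> H i))"
      using assms(1) finH disj by (intro card_UN_disjoint) (simp, simp, blast)
    finally show ?thesis .
  qed
  \<comment> \<open>Distinct positions in a range of length \<open>D * 4 ^ D\<close> bound the
    number of regions and thereby, with \<open>D(2)\<close>, the size of every query.\<close>
  have "card I \<le> card {B * (D * 4 ^ D)..<B * (D * 4 ^ D) + D * 4 ^ D}"
  proof (rule card_inj_on_le)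
    show "inj_on p I"
    proof (rule inj_onI)
      fix i j assume "i \<in> I" "j \<in> I" "p i = p j"
      then show "i = j" using p(2)[of i j] b(1)[of i] b(1)[of j] by fastforce
    qed
    show "p ` I \<subseteq> {B * (D * 4 ^ D)..<B * (D * 4 ^ D) + D * 4 ^ D}"
    proof
      fix y assume "y \<in> p ` I"
      then have "y div (D * 4 ^ D) = B" using p(3) by (auto simp: div_mult2_eq)
      moreover have "y div (D * 4 ^ D) * (D * 4 ^ D) + y mod (D * 4 ^ D) = y"
        "y mod (D * 4 ^ D) < D * 4 ^ D"
        by (rule div_mult_mod_eq) (use D(1) in simp)
      ultimately show "y \<in> {B * (D * 4 ^ D)..<B * (D * 4 ^ D) + D * 4 ^ D}"
        unfolding atLeastLessThan_iff by (metis add_less_cancel_left le_add1)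
    qed
  qed simp
  then have card_I: "card I \<le> 4 ^ D * D" by (simp add: mult.commute)
  have X: "X q \<in> sparse_sets n k" for q
  proof -
    have "card (X q) \<le> (\<Sum>i | i \<in> I \<and> q \<inter> T i \<in> G i. card (H i))"
      unfolding X_def using assms(1) by (intro card_UN_le) simp
    also have "\<dots> \<le> (\<Sum>i\<in>I. card (H i))"
      using assms(1) by (intro sum_mono2) auto
    also have "\<dots> \<le> card I * z"
      using sum_mono[of I "\<lambda>i. card (H i)" "\<lambda>_. z"] H by simp
    also have "\<dots> \<le> 4 ^ D * D * z" using card_I by (rule mult_right_mono) simp
    also have "\<dots> \<le> n" by (rule D(2))
    finally show ?thesis using H by (auto simp: sparse_sets_def X_def)
  qed
  show ?thesis
  proof (rule revealsI[of "X ` Pow ?U"])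
    show "X ` Pow ?U \<subseteq> sparse_sets n k" using X by blast
    have "card (X ` Pow ?U) \<le> card (Pow ?U)" by (rule card_image_le) simp
    then show "card (X ` Pow ?U) \<le> 2 * 4 ^ D" by (simp add: card_Pow power_mult)
    fix f g A
    assume fg: "f \<in> F" "g \<in> F" and agree: "\<And>q. q \<in> X ` Pow ?U \<Longrightarrow> card (f \<inter> q) = card (g \<inter> q)"
      and "A \<in> H ` I"
    then obtain i where i: "i \<in> I" "A = H i" by blast
    have "card (f \<inter> H i) = card (g \<inter> H i)"
    proof (rule weighing_design_injective[where I = I and U = ?U and T = T and G = G and b = b
          and p = "\<lambda>i. p i mod D" and c = "\<lambda>i. card (f \<inter> H i)" and c' = "\<lambda>i. card (g \<inter> H i)"])
      show "p i mod D + b i \<le> p j mod D \<or> p j mod D + b j \<le> p i mod D"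
        if "i \<in> I" "j \<in> I" "i \<noteq> j" "T i = T j" for i j
      proof -
        have "p i div D mod 4 ^ D = p j div D mod 4 ^ D"
          using inj_onD[OF e(2), of "p i div D mod 4 ^ D" "p j div D mod 4 ^ D"] that(4)
          by (simp add: T_def)
        \<comment> \<open>In one block, equal index sets mean the same word, where the windows are
          disjoint.\<close>
        then have "p i div D = p j div D"
          using p(3)[OF that(1)] p(3)[OF that(2)] by (metis div_mult_mod_eq)
        moreover have "p i div D * D + p i mod D = p i" "p j div D * D + p j mod D = p j"
          by (rule div_mult_mod_eq)+
        ultimately have "p i div D * D + p i mod D = p i" "p i div D * D + p j mod D = p j" by simp_all
        then show ?thesis using p(2)[OF that(1-3)] by linarith
      qed
      show "(\<Sum>i | i \<in> I \<and> q \<inter> T i \<in> G i. card (f \<inter> H i)) =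
          (\<Sum>i | i \<in> I \<and> q \<inter> T i \<in> G i. card (g \<inter> H i))" if "q \<subseteq> ?U" for q
        using agree[of "X q"] that unfolding card_X by blast
    qed (use assms(1) T G b(2) fg i in auto)
    then show "card (f \<inter> A) = card (g \<inter> A)" using i by simp
  qed simp
qed

text \<open>Packing at most doubles the \<open>W\<close> bits, which gives the number of
  blocks.\<close>

lemma reveals_weighing:
  fixes H :: "'i \<Rightarrow> nat set"
  assumes "finite I" and H: "\<And>i. i \<in> I \<Longrightarrow> H i \<subseteq> {1..k} \<and> card (H i) \<le> z"
    and disj: "\<And>i j. i \<in> I \<Longrightarrow> j \<in> I \<Longrightarrow> i \<noteq> j \<Longrightarrow> H i \<inter> H j = {}"
    and b: "\<And>i. i \<in> I \<Longrightarrow> 1 \<le> b i \<and> b i \<le> D" "\<And>i f. i \<in> I \<Longrightarrow> f \<in> F \<Longrightarrow> card (f \<inter> H i) < 2 ^ b i"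
    and W: "sum b I \<le> W"
    and D: "0 < D" "4 ^ D * D * z \<le> n"
  shows "reveals ((2 * W div (D * 4 ^ D) + 1) * (2 * 4 ^ D)) F (H ` I)"
proof -
  have "\<exists>p. (\<forall>i\<in>I. p i + b i \<le> 2 * sum b I \<and> p i mod D + b i \<le> D) \<and>
      (\<forall>i\<in>I. \<forall>j\<in>I. i \<noteq> j \<longrightarrow> p i + b i \<le> p j \<or> p j + b j \<le> p i)"
    using b(1) by (intro ex_packing[OF assms(1) D(1)]) blast
  then obtain p where p: "\<forall>i\<in>I. p i + b i \<le> 2 * sum b I \<and> p i mod D + b i \<le> D"
    "\<forall>i\<in>I. \<forall>j\<in>I. i \<noteq> j \<longrightarrow> p i + b i \<le> p j \<or> p j + b j \<le> p i"
    by (elim exE conjE)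
  let ?m = "2 * W div (D * 4 ^ D) + 1"
  let ?I = "\<lambda>B. {i\<in>I. p i div D div 4 ^ D = B}"
  have rev: "reveals (card {..<?m} * (2 * 4 ^ D)) F (\<Union>B<?m. H ` ?I B)"
  proof (rule reveals_UN_bound)
    show "reveals (2 * 4 ^ D) F (H ` ?I B)" for B
    proof (rule reveals_weighing_block[where b = b and p = p and z = z and B = B])
      show "p i + b i \<le> p j \<or> p j + b j \<le> p i" if "i \<in> ?I B" "j \<in> ?I B" "i \<noteq> j" for i j
        using p(2) that by blast
    qed (use assms p(1) in auto)
  qed simp
  have "p i div D div 4 ^ D < ?m" if "i \<in> I" for i
  proof -
    have "p i \<le> 2 * W" using p(1) that W by fastforce
    then have "p i div (D * 4 ^ D) \<le> 2 * W div (D * 4 ^ D)" by (rule div_le_mono)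
    then show ?thesis by (simp add: div_mult2_eq)
  qed
  then have "H ` I = (\<Union>B<?m. H ` ?I B)" by fastforce
  then show ?thesis using rev by simp
qed

text \<open>A count \<open>s\<close> is allotted \<open>min s D\<close> bits: wasteful for one
  region, but at most \<open>n\<close> bits in total, so the cost of a round depends neither on the
  number of regions nor on their size.\<close>

lemma solvable_halving:
  assumes D: "d0 < D" "4 ^ D * D * 2 ^ d0 \<le> n"
    and "d \<le> d0" "position \<P> f" "\<And>R. R \<in> \<P> \<Longrightarrow> card R \<le> 2 ^ d"
  shows "solvable (d * ((2 * n div (D * 4 ^ D) + 1) * (2 * 4 ^ D))) (consistent \<P> f)"
  using assms(3-)
proof (induction d arbitrary: \<P> f)
  case 0
  have "solvable 0 (consistent \<P> f)" by (rule solvable_singletons[OF 0(2)]) (use 0(3) in simp)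
  then show ?case by (simp del: solvable.simps)
next
  case (Suc d)
  note pos = Suc.prems(2)
  let ?q = "(2 * n div (D * 4 ^ D) + 1) * (2 * 4 ^ D)"
  let ?s = "\<lambda>R. card (f \<inter> R)"
  have dis: "pairwise disjnt \<P>" and fin: "finite \<P>" using pos by (auto simp: position_def)
  have "\<exists>pt :: nat \<Rightarrow> nat. \<forall>R\<in>\<P>. (\<forall>x\<in>R. pt x < 2) \<and> (\<forall>i. card {x\<in>R. pt x = i} \<le> 2 ^ d)"
    using position_finite(4)[OF pos] Suc.prems(3) by (intro ex_common_cut[OF dis]) simp
  then obtain pt :: "nat \<Rightarrow> nat" where pt: "\<And>R x. R \<in> \<P> \<Longrightarrow> x \<in> R \<Longrightarrow> pt x < 2"
    "\<And>R i. R \<in> \<P> \<Longrightarrow> card {x\<in>R. pt x = i} \<le> 2 ^ d"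
    by blast
  let ?H = "\<lambda>R. {x\<in>R. pt x = 0}"
  have rev: "reveals ?q (consistent \<P> f) (?H ` \<P>)"
  proof (rule reveals_weighing[where b = "\<lambda>R. min (?s R) D" and z = "2 ^ d"])
    show "?H R \<subseteq> {1..k} \<and> card (?H R) \<le> 2 ^ d" if "R \<in> \<P>" for R
      using pt(2)[OF that, of 0] that pos by (auto simp: position_def)
    show "?H R \<inter> ?H R' = {}" if "R \<in> \<P>" "R' \<in> \<P>" "R \<noteq> R'" for R R'
    proof -
      have "disjnt R R'" using dis that by (rule pairwiseD)
      then show ?thesis by (auto simp: disjnt_def)
    qed
    show "1 \<le> min (?s R) D \<and> min (?s R) D \<le> D" if "R \<in> \<P>" for R
      using position_pos[OF pos that] D(1) by auto
    show "card (g \<inter> ?H R) < 2 ^ min (?s R) D" if "R \<in> \<P>" "g \<in> consistent \<P> f" for R g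
    proof -
      have finR: "finite R" by (rule position_finite(4)[OF pos that(1)])
      have "card (g \<inter> ?H R) \<le> card (g \<inter> R)" using finR by (intro card_mono) auto
      also have "\<dots> = ?s R" using that by (simp add: consistent_def)
      also have "?s R < 2 ^ min (?s R) D"
      proof (cases "?s R \<le> D")
        case True
        then show ?thesis by (simp add: min_absorb1)
      next
        \<comment> \<open>The cap is harmless because a region has at most
          \<open>2 ^ Suc d < 2 ^ D\<close> elements.\<close>
        case False
        have "?s R \<le> card R" using finR by (intro card_mono) auto
        also have "\<dots> \<le> 2 ^ Suc d" using Suc.prems(3) that by blast
        also have "\<dots> < (2::nat) ^ D" using Suc.prems(1) D(1) by (intro power_strict_increasing) auto
        finally show ?thesis using False by (simp add: min_absorb2)
      qed
      finally show ?thesis .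
    qed
    have "(\<Sum>R\<in>\<P>. min (?s R) D) \<le> (\<Sum>R\<in>\<P>. ?s R)" by (intro sum_mono) simp
    also have "\<dots> \<le> n" by (rule position_sum(2)[OF pos order_refl])
    finally show "(\<Sum>R\<in>\<P>. min (?s R) D) \<le> n" .
    have "4 ^ D * D * 2 ^ d \<le> 4 ^ D * D * (2::nat) ^ d0"
      using Suc.prems(1) by (intro mult_left_mono power_increasing) auto
    then show "4 ^ D * D * 2 ^ d \<le> n" using D(2) by (rule order_trans)
  qed (use fin D in auto)
  \<comment> \<open>Only the halves with \<open>pt x = 0\<close> were weighed; the others follow by
    subtraction from the known counts.\<close>
  have "reveals ?q (consistent \<P> f) {{x\<in>R. pt x = i} | R i. R \<in> \<P> \<and> i < 2}"
  proof (rule reveals_trans[OF rev _ order_refl])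
    fix g g' A
    assume g: "g \<in> consistent \<P> f" "g' \<in> consistent \<P> f"
      and agree: "\<And>A. A \<in> ?H ` \<P> \<Longrightarrow> card (g \<inter> A) = card (g' \<inter> A)"
      and "A \<in> {{x\<in>R. pt x = i} | R i. R \<in> \<P> \<and> i < 2}"
    then obtain R i where R: "R \<in> \<P>" "i < 2" "A = {x\<in>R. pt x = i}" by blast
    have finR: "finite R" by (rule position_finite(4)[OF pos R(1)])
    have zero: "card (g \<inter> ?H R) = card (g' \<inter> ?H R)" by (rule agree) (use R(1) in blast)
    have all: "card (g \<inter> R) = card (g' \<inter> R)" using g R(1) by (simp add: consistent_def)
    have split: "card (h \<inter> R) = card (h \<inter> ?H R) + card (h \<inter> {x\<in>R. pt x = 1})" for h
    proof -
      have "h \<inter> R = (h \<inter> ?H R) \<union> (h \<inter> {x\<in>R. pt x = 1})"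
        using pt(1)[OF R(1)] by (auto simp: less_2_cases_iff)
      also have "card \<dots> = card (h \<inter> ?H R) + card (h \<inter> {x\<in>R. pt x = 1})"
        using finR by (intro card_Un_disjoint) auto
      finally show ?thesis .
    qed
    have "i = 0 \<or> i = 1" using R(2) by auto
    then show "card (g \<inter> A) = card (g' \<inter> A)"
      unfolding R(3) using zero all split[of g] split[of g'] by (elim disjE) simp_all
  qed
  then have "solvable (?q + d * ?q) (consistent \<P> f)"
  proof (rule solvable_refine[OF pos order_refl, rotated])
    show "pt x < 2" if "x \<in> \<Union>\<P>" for x using that pt(1) by blast
    fix \<P>' h
    assume pos': "position \<P>' h"
      and new: "\<And>P. P \<in> \<P>' \<Longrightarrow> P \<in> \<P> - \<P> \<or> (\<exists>R\<in>\<P>. \<exists>i<2. P = {x\<in>R. pt x = i})"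
    have "card P \<le> 2 ^ d" if "P \<in> \<P>'" for P
      using new[OF that] pt(2) by auto
    then show "solvable (d * ?q) (consistent \<P>' h)"
      using Suc.prems(1) by (intro Suc.IH[OF _ pos']) auto
  qed
  then show ?case by simp
qed

text \<open>The first weighing has no known counts to rely on and allots \<open>d + 1\<close> bits
  to each of \<open>n\<close> regions; each of the \<open>d\<close> halvings needs only
  \<open>n\<close> bits. The factor \<open>D\<close> clears the division in the cost of a
  weighing.\<close>

lemma min_queries_sparse:
  assumes "k \<le> n * 2 ^ d" "d < D" "4 ^ D * D * 2 ^ d \<le> n"
  shows "D * min_queries n k \<le> 10 * n * (d + 1)"
proof -
  let ?N = "\<lambda>W. (2 * W div (D * 4 ^ D) + 1) * (2 * 4 ^ D)"
  obtain pt :: "nat \<Rightarrow> nat" where pt: "\<forall>x\<in>{1..k}. pt x < n" "\<forall>i. card {x\<in>{1..k}. pt x = i} \<le> 2 ^ d"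
    using ex_cut[of "{1..k}" n "2 ^ d"] assms(1) by auto
  let ?H = "\<lambda>i. {x\<in>{1..k}. pt x = i}"
  have "reveals (?N (n * (d + 1))) (sparse_sets n k) (?H ` {..<n})"
  proof (rule reveals_weighing[where b = "\<lambda>_. d + 1" and z = "2 ^ d"])
    show "card (f \<inter> ?H i) < 2 ^ (d + 1)" for f i
    proof -
      have "card (f \<inter> ?H i) \<le> card (?H i)" by (intro card_mono) auto
      also have "\<dots> \<le> 2 ^ d" using pt(2) by blast
      also have "\<dots> < 2 ^ (d + 1)" by simp
      finally show ?thesis .
    qed
  qed (use assms pt in auto)
  then have "solvable (?N (n * (d + 1)) + d * ?N n) (sparse_sets n k)"
  proof (rule solvable_partition)
    show "f \<subseteq> \<Union>(?H ` {..<n}) \<and> card f \<le> n" if "f \<in> sparse_sets n k" for f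
      using that pt(1) by (auto simp: sparse_sets_def)
    show "solvable (d * ?N n) (consistent \<P> f)" if "position \<P> f" "\<P> \<subseteq> ?H ` {..<n}" for \<P> f
    proof (rule solvable_halving[OF assms(2,3) order_refl that(1)])
      show "card R \<le> 2 ^ d" if "R \<in> \<P>" for R
        using that \<open>\<P> \<subseteq> ?H ` {..<n}\<close> pt(2) by blast
    qed
  qed (auto simp: pairwise_def disjnt_def)
  then have "min_queries n k \<le> ?N (n * (d + 1)) + d * ?N n" by (rule min_queries_le)
  then have "D * min_queries n k \<le> D * ?N (n * (d + 1)) + d * (D * ?N n)"
    by (metis (no_types, lifting) add_mult_distrib2 mult.left_commute mult_le_mono2)
  also have "\<dots> \<le> (4 * (n * (d + 1)) + 2 * n) + d * (4 * n + 2 * n)"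
  proof -
    have "D * ?N W \<le> 4 * W + 2 * n" for W
    proof -
      have "D * ?N W = 2 * (2 * W div (D * 4 ^ D) * (D * 4 ^ D)) + 2 * (4 ^ D * D)"
        by (simp add: algebra_simps)
      also have "\<dots> \<le> 2 * (2 * W) + 2 * n"
      proof (intro add_mono mult_left_mono)
        have "4 ^ D * D * 1 \<le> 4 ^ D * D * (2::nat) ^ d" by (intro mult_left_mono) auto
        then show "4 ^ D * D \<le> n" using assms(3) by linarith
      qed (simp_all add: div_times_less_eq_dividend)
      finally show ?thesis by simp
    qed
    then show ?thesis by (intro add_mono mult_left_mono) (assumption | rule le0)+
  qed
  also have "\<dots> \<le> 10 * n * (d + 1)" by (simp add: algebra_simps)
  finally show ?thesis .
qed

end

section \<open>Lower bound and conclusion\<close>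

lemma solvable_within_inj:
  assumes "solvable_within n k T"
  shows "\<exists>S. valid_strategy n k S \<and> inj_on (\<lambda>f. answers S f T) (sparse_sets n k)"
proof -
  obtain S where S: "valid_strategy n k S"
    "\<And>f. f \<in> sparse_sets n k \<Longrightarrow> \<exists>t\<le>T. solved_after n k S f t"
    using assms unfolding solvable_within_def by blast
  have "f = g" if fg: "f \<in> sparse_sets n k" "g \<in> sparse_sets n k" "answers S f T = answers S g T" for f g
  proof -
    obtain t where t: "t \<le> T" "solved_after n k S f t" using S(2)[OF fg(1)] by blast
    then have "answers S g t = answers S f t" using answers_prefix[OF fg(3)] by simp
    then show ?thesis using t(2) fg(2) unfolding solved_after_def by blast
  qed
  then show ?thesis using S(1) by (auto simp: inj_on_def)
qed

lemma finite_sparse_sets: "finite (sparse_sets n k)"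
  by (rule finite_subset[of _ "Pow {1..k}"]) (auto simp: sparse_sets_def)

lemma card_sparse_sets_le:
  assumes "solvable_within n k T"
  shows "card (sparse_sets n k) \<le> (n + 1) ^ T"
proof -
  obtain S where S: "valid_strategy n k S" "inj_on (\<lambda>f. answers S f T) (sparse_sets n k)"
    using solvable_within_inj[OF assms] by blast
  have ans: "set (answers S f t) \<subseteq> {..n}" for f t
  proof (induction t)
    case (Suc t)
    have "S (answers S f t) \<subseteq> {1..k}" "card (S (answers S f t)) \<le> n"
      using S(1) by (auto simp: valid_strategy_def sparse_sets_def)
    moreover have "card (f \<inter> S (answers S f t)) \<le> card (S (answers S f t))"
      using \<open>S (answers S f t) \<subseteq> {1..k}\<close> by (intro card_mono) (auto intro: finite_subset)
    ultimately show ?case using Suc by (simp add: Let_def)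
  qed simp
  have "card (sparse_sets n k) \<le> card {xs. set xs \<subseteq> {..n} \<and> length xs = T}"
    using S(2) ans by (intro card_inj_on_le[of "\<lambda>f. answers S f T"]) (auto simp: finite_lists_length_eq)
  also have "\<dots> = (n + 1) ^ T" by (simp add: card_lists_length_eq)
  finally show ?thesis .
qed

text \<open>As long as only zeros are answered, an unqueried coin cannot be told from no coin.\<close>

lemma size_le_queries:
  assumes "solvable_within n k T" "1 \<le> n"
  shows "k \<le> T * n"
proof -
  obtain S where S: "valid_strategy n k S" "inj_on (\<lambda>f. answers S f T) (sparse_sets n k)"
    using solvable_within_inj[OF assms(1)] by blast
  let ?q = "\<lambda>t. S (answers S {} t)"
  have q: "?q t \<subseteq> {1..k}" "card (?q t) \<le> n" for t
    using S(1) by (auto simp: valid_strategy_def sparse_sets_def)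
  have "{1..k} \<subseteq> (\<Union>t<T. ?q t)"
  proof
    fix x assume x: "x \<in> {1..k}"
    show "x \<in> (\<Union>t<T. ?q t)"
    proof (rule ccontr)
      assume new: "x \<notin> (\<Union>t<T. ?q t)"
      have "answers S {x} t = answers S {} t" if "t \<le> T" for t
        using that new by (induction t) (auto simp: Let_def)
      moreover have "{x} \<in> sparse_sets n k" "{} \<in> sparse_sets n k"
        using x assms(2) by (auto simp: sparse_sets_def)
      ultimately have "{x} = {}" using inj_onD[OF S(2), of "{x}" "{}"] by simp
      then show False by simp
    qed
  qed
  then have "card {1..k} \<le> card (\<Union>t<T. ?q t)"
    using q(1) by (intro card_mono) (auto intro: finite_subset)
  also have "\<dots> \<le> (\<Sum>t<T. card (?q t))" by (rule card_UN_le) simp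
  also have "\<dots> \<le> T * n" using sum_mono[of "{..<T}" "\<lambda>t. card (?q t)" "\<lambda>_. n"] q(2) by simp
  finally show ?thesis by simp
qed

text \<open>The binomial estimate is trivial at \<open>k = n\<close>, where the subsets of
  \<open>{1..n}\<close> take over.\<close>

lemma card_sparse_sets_ge:
  assumes "1 \<le> n" "n \<le> k"
  shows "2 ^ n \<le> card (sparse_sets n k)" "(real k / real n) ^ n \<le> real (card (sparse_sets n k))"
proof -
  have "card (Pow {1..n}) \<le> card (sparse_sets n k)"
  proof (rule card_mono[OF finite_sparse_sets])
    show "Pow {1..n} \<subseteq> sparse_sets n k"
    proof
      fix A assume A: "A \<in> Pow {1..n}"
      then have "card A \<le> n" using card_mono[of "{1..n}" A] by simp
      then show "A \<in> sparse_sets n k" using A assms(2) by (force simp: sparse_sets_def)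
    qed
  qed
  then show "2 ^ n \<le> card (sparse_sets n k)" by (simp add: card_Pow)
  have "card {A. A \<subseteq> {1..k} \<and> card A = n} \<le> card (sparse_sets n k)"
    by (rule card_mono[OF finite_sparse_sets]) (auto simp: sparse_sets_def)
  then have "k choose n \<le> card (sparse_sets n k)" by (simp add: n_subsets)
  moreover have "(real k / real n) ^ n \<le> real (k choose n)"
    using binomial_ge_n_over_k_pow_k[OF assms(2), where 'a = real] by simp
  ultimately show "(real k / real n) ^ n \<le> real (card (sparse_sets n k))" by linarith
qed

lemma ln2_bounds: "1 / 2 \<le> ln (2::real)" "ln (2::real) \<le> 1"
  using ln_add_one_self_le_self2[of 1] ln_one_minus_pos_upper_bound[of "1 / 2"]
  by (simp_all add: ln_div)

text \<open>\<open>ln (1 + x) \<le> ln 2 + ln x\<close> calls for both counting bounds. Two of them,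
  and \<open>ln (n + 1) \<le> 2 * ln n\<close>, give the factor 4; covering all coins adds
  1.\<close>

lemma query_bound_le_min_queries:
  assumes "1 \<le> n" "n \<le> k"
  shows "query_bound n k \<le> 5 * real (min_queries n k)"
proof -
  let ?T = "min_queries n k"
  define x where "x = real k / real n"
  have x: "1 \<le> x" using assms by (simp add: x_def)
  have sol: "solvable_within n k ?T" using assms(1) by (rule solvable_within_min_queries)
  have "real k \<le> real ?T * real n"
    using size_le_queries[OF sol assms(1)] by (metis of_nat_le_iff of_nat_mult)
  then have second: "x \<le> real ?T" using assms(1) by (simp add: x_def field_simps)
  have first: "real n * (ln (1 + x) / ln (real n)) \<le> 4 * real ?T"
  proof (cases "n = 1")
    case False
    then have n2: "2 \<le> n" using assms(1) by simp
    have upper: "real (card (sparse_sets n k)) \<le> (real n + 1) ^ ?T"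
      using card_sparse_sets_le[OF sol] by (metis of_nat_1 of_nat_add of_nat_le_iff of_nat_power)
    have lower: "real n * ln y \<le> real ?T * ln (real n + 1)"
      if "y ^ n \<le> real (card (sparse_sets n k))" "0 < y" for y
    proof -
      have "ln (y ^ n) \<le> ln ((real n + 1) ^ ?T)"
        using that upper by (intro ln_mono) (auto intro: order_trans)
      then show ?thesis using that(2) by (simp add: ln_realpow)
    qed
    have "real n * ln 2 \<le> real ?T * ln (real n + 1)"
    proof (rule lower)
      have "real (2 ^ n) \<le> real (card (sparse_sets n k))"
        using card_sparse_sets_ge(1)[OF assms] by (simp only: of_nat_le_iff)
      then show "2 ^ n \<le> real (card (sparse_sets n k))" by simp
    qed simp
    moreover have "real n * ln x \<le> real ?T * ln (real n + 1)"
      using card_sparse_sets_ge(2)[OF assms] x by (intro lower) (auto simp: x_def)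
    moreover have "ln (1 + x) \<le> ln 2 + ln x"
    proof -
      have "ln (1 + x) \<le> ln (2 * x)" using x by (intro ln_mono) auto
      then show ?thesis using x by (simp add: ln_mult)
    qed
    then have "real n * ln (1 + x) \<le> real n * ln 2 + real n * ln x"
      using mult_left_mono[of "ln (1 + x)" "ln 2 + ln x" "real n"] by (simp add: distrib_left)
    ultimately have "real n * ln (1 + x) \<le> 2 * (real ?T * ln (real n + 1))" by linarith
    also have "ln (real n + 1) \<le> ln (real n ^ 2)"
    proof (rule ln_mono)
      have "2 * real n \<le> real n * real n" using n2 by (intro mult_right_mono) auto
      then show "real n + 1 \<le> real n ^ 2" using n2 unfolding power2_eq_square by linarith
    qed simp
    then have "2 * (real ?T * ln (real n + 1)) \<le> 2 * (real ?T * ln (real n ^ 2))"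
      by (intro mult_left_mono) auto
    finally have "real n * ln (1 + x) \<le> 4 * real ?T * ln (real n)"
      using n2 by (simp add: ln_realpow)
    moreover have "0 < ln (real n)" using n2 by simp
    ultimately show ?thesis by (simp add: pos_divide_le_eq)
  qed simp
  show ?thesis
    using first second unfolding query_bound_def x_def by linarith
qed

lemma min_queries_le_size: "1 \<le> n \<Longrightarrow> min_queries n k \<le> k"
  unfolding min_queries_def by (rule Least_le) (rule solvable_within_k)

lemma ln_le_of_lt_power16:
  assumes "1 \<le> n" "n < 16 ^ Suc D" "1 \<le> D"
  shows "ln (real n) \<le> 8 * real D"
proof -
  have "real n \<le> real (16 ^ Suc D)" using assms(2) by (simp only: of_nat_le_iff less_imp_le)
  then have "ln (real n) \<le> ln (16 ^ Suc D)" using assms(1) by (intro ln_mono) auto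
  also have "\<dots> = real (Suc D) * ln 16" by (rule ln_realpow)
  also have "\<dots> = real (Suc D) * (4 * ln 2)" using ln_realpow[of 2 4] by simp
  also have "\<dots> \<le> real (Suc D) * (4 * 1)" using ln2_bounds(2) by (intro mult_left_mono) auto
  also have "\<dots> \<le> 8 * real D" using assms(3) by simp
  finally show ?thesis .
qed

lemma le_ln_of_power2_le:
  assumes "2 ^ e \<le> x"
  shows "real e / 2 \<le> ln (1 + x)"
proof -
  have "real e / 2 \<le> real e * ln 2" using ln2_bounds(1) mult_left_mono[of "1 / 2" "ln 2" "real e"] by simp
  also have "\<dots> = ln (2 ^ e)" by (simp add: ln_realpow)
  also have "\<dots> \<le> ln (1 + x)" using assms by (intro ln_mono) auto
  finally show ?thesis .
qed

lemma min_queries_le_query_bound: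
  assumes "1 \<le> n" "n \<le> k"
  shows "real (min_queries n k) \<le> 20000 * query_bound n k"
proof -
  interpret sparse_query n k by unfold_locales (rule assms(1))
  define x where "x = real k / real n"
  have x: "1 \<le> x" and nx: "real k = real n * x" using assms by (simp_all add: x_def)
  define A where "A = real n * (ln (1 + x) / ln (real n))"
  have A: "0 \<le> A"
    using assms(1) x by (auto simp: A_def intro!: mult_nonneg_nonneg divide_nonneg_nonneg)
  have qb: "query_bound n k = A + x" by (simp add: query_bound_def A_def x_def)
  \<comment> \<open>For small \<open>n\<close> one query per coin suffices. From
    \<open>256 = 16 ^ 2\<close> on, \<open>D \<ge> 2\<close>, which keeps \<open>D - 1\<close>
    comparable to \<open>D\<close>.\<close>
  show ?thesis
  proof (cases "n < 256")
    case True
    have "real (min_queries n k) \<le> real k"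
      using min_queries_le_size[OF assms(1)] by simp
    also have "\<dots> \<le> 256 * x"
      unfolding nx using True x by (intro mult_right_mono) auto
    finally show ?thesis unfolding qb using A x by simp
  next
    case False
    obtain D where D: "16 ^ D \<le> n" "n < 16 ^ Suc D"
      using ex_power_ivl1[of 16 n] assms(1) by auto
    have "D \<ge> 2"
    proof (rule ccontr)
      assume "\<not> D \<ge> 2"
      then have "(16::nat) ^ Suc D \<le> 16 ^ 2" by (intro power_increasing) auto
      then show False using D(2) False by simp
    qed
    have ln_n: "0 < ln (real n)" "ln (real n) \<le> 8 * real D"
      using False ln_le_of_lt_power16[OF assms(1) D(2)] \<open>D \<ge> 2\<close> by auto
    have A_ge: "real n * (ln (1 + x) / (8 * real D)) \<le> A"
      unfolding A_def using ln_n x \<open>D \<ge> 2\<close> by (intro mult_left_mono divide_left_mono) auto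
    show ?thesis
    proof (cases "\<exists>d<D. k \<le> n * 2 ^ d")
      case True
      define d where "d = (LEAST d. k \<le> n * 2 ^ d)"
      obtain d' where d': "d' < D" "k \<le> n * 2 ^ d'" using True by blast
      have kd: "k \<le> n * 2 ^ d" unfolding d_def using d'(2) by (rule LeastI)
      have "d \<le> d'" unfolding d_def using d'(2) by (rule Least_le)
      then have dD: "d < D" using d'(1) by simp
      \<comment> \<open>The origin of base 16: both \<open>D\<close> and \<open>2 ^ d\<close> are
        bounded by \<open>2 ^ D\<close>.\<close>
      have "4 ^ D * D * 2 ^ d \<le> 4 ^ D * 2 ^ D * (2::nat) ^ D"
        using dD by (intro mult_mono power_increasing) (auto intro: less_imp_le)
      also have "\<dots> = 16 ^ D" by (simp flip: power_mult_distrib)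
      finally have "4 ^ D * D * 2 ^ d \<le> n" using D(1) by simp
      then have "D * min_queries n k \<le> 10 * n * (d + 1)" by (rule min_queries_sparse[OF kd dD])
      then have "real (D * min_queries n k) \<le> real (10 * n * (d + 1))"
        by (simp only: of_nat_le_iff)
      then have T: "real D * real (min_queries n k) \<le> 10 * real n * (real d + 1)"
        by (simp add: algebra_simps)
      have "ln 2 \<le> ln (1 + x)" using x by (intro ln_mono) auto
      then have half: "1 / 2 \<le> ln (1 + x)" using ln2_bounds(1) by linarith
      have "real d + 1 \<le> 8 * ln (1 + x)"
      proof (cases d)
        case 0
        then show ?thesis using half by simp
      next
        case (Suc e)
        have "\<not> k \<le> n * 2 ^ e" using not_less_Least[of e "\<lambda>d. k \<le> n * 2 ^ d"] Suc by (simp add: d_def)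
        then have "real (n * 2 ^ e) \<le> real k" by (simp only: of_nat_le_iff)
        then have "2 ^ e \<le> x" using assms(1) by (simp add: nx)
        then show ?thesis
          using le_ln_of_power2_le[of e x] half Suc by simp
      qed
      then have "10 * real n * (real d + 1) \<le> 10 * real n * (8 * ln (1 + x))"
        by (intro mult_left_mono) auto
      with T have "real D * real (min_queries n k) \<le> 80 * (real n * ln (1 + x))" by simp
      then have "real (min_queries n k) \<le> 640 * (real n * (ln (1 + x) / (8 * real D)))"
        using dD by (simp add: field_simps)
      also have "\<dots> \<le> 640 * A" using A_ge by (rule mult_left_mono) simp
      finally show ?thesis unfolding qb using A x by simp
    next
      case dense: False
      \<comment> \<open>Here \<open>x\<close> exceeds a fixed power of \<open>n\<close> up to a
        constant, so \<open>ln (1 + x)\<close> is at least of order \<open>D\<close>, and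
        \<open>A\<close> alone pays for a multiple of \<open>n\<close> queries.\<close>
      then have "\<not> k \<le> n * 2 ^ (D - 1)" using \<open>D \<ge> 2\<close> by auto
      then have "real (n * 2 ^ (D - 1)) \<le> real k" by (simp only: of_nat_le_iff)
      then have "2 ^ (D - 1) \<le> x" using assms(1) by (simp add: nx)
      then have "real (D - 1) / 2 \<le> ln (1 + x)" by (rule le_ln_of_power2_le)
      then have "real D / 4 \<le> ln (1 + x)" using \<open>D \<ge> 2\<close> by (simp add: of_nat_diff)
      then have "1 / 32 \<le> ln (1 + x) / (8 * real D)" using \<open>D \<ge> 2\<close> by (simp add: field_simps)
      then have "real n * (1 / 32) \<le> real n * (ln (1 + x) / (8 * real D))"
        by (intro mult_left_mono) auto
      then have "real n * (1 / 32) \<le> A" using A_ge by (rule order_trans)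
      then have n_le: "real n \<le> 32 * A" by simp
      obtain L where L: "4 ^ L \<le> n" "n < 4 ^ Suc L"
        using ex_power_ivl1[of 4 n] assms(1) by auto
      have "1 \<le> L" using L(2) False by (cases L) auto
      then have "min_queries n k \<le> k div 4 ^ L + 1 + 448 * 4 ^ L"
        by (rule min_queries_dense[OF _ L])
      also have "\<dots> \<le> k div 4 ^ L + 449 * n" using L(1) assms(1) by simp
      finally have "real (min_queries n k) \<le> real (k div 4 ^ L + 449 * n)"
        by (simp only: of_nat_le_iff)
      then have "real (min_queries n k) \<le> real (k div 4 ^ L) + 449 * real n"
        by simp
      moreover have "real (k div 4 ^ L) \<le> 4 * x"
      proof -
        have "real (k div 4 ^ L) \<le> real k / 4 ^ L"
          using of_nat_div_le_of_nat[of k "4 ^ L", where 'a = real] by simp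
        also have "\<dots> \<le> 4 * x"
        proof -
          have "real n \<le> real (4 ^ Suc L)" using L(2) by (simp only: of_nat_le_iff less_imp_le)
          then have "real n * x \<le> 4 * 4 ^ L * x" using x by (intro mult_right_mono) auto
          then show ?thesis by (simp add: nx field_simps)
        qed
        finally show ?thesis .
      qed
      moreover have "449 * real n \<le> 14368 * A" using n_le by simp
      ultimately have "real (min_queries n k) \<le> 4 * x + 14368 * A" by simp
      also have "\<dots> \<le> 20000 * x + 20000 * A" using A x by (intro add_mono mult_right_mono) auto
      finally show ?thesis unfolding qb by (simp add: distrib_left)
    qed
  qed
qed

theorem theorem3:
  shows "\<exists>c C :: real. 0 < c \<and> 0 < C \<and>
    (\<forall>n k :: nat. 1 \<le> n \<longrightarrow> n \<le> k \<longrightarrow>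
       c * query_bound n k \<le> real (min_queries n k) \<and>
       real (min_queries n k) \<le> C * query_bound n k)"
proof (intro exI conjI allI impI)
  fix n k :: nat assume nk: "1 \<le> n" "n \<le> k"
  show "1 / 5 * query_bound n k \<le> real (min_queries n k)"
    using query_bound_le_min_queries[OF nk] by simp
  show "real (min_queries n k) \<le> 20000 * query_bound n k"
    by (rule min_queries_le_query_bound[OF nk])
qed simp_all

end
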